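(* Let $\mathcal{M}=(D;\rho,\tau)$ be an oriented hypermap whose underlying hypergraph $\Gamma$ is simple. Then $\mathcal{M}$ is a Cayley hypermap (that is, isomorphic to some $\mathrm{CM}(G,Y,\rho_{[Y]},\tau_{[r]})$) if and only if $\mathrm{Aut}(\mathcal{M})$ contains a subgroup which induces a regular action on the hypervertex set of $\Gamma$.
   Context: Permutations act on the right; $[r]=\{1,\ldots,r\}$; groups are finite. Oriented hypermaps. An oriented hypermap $(D;\rho,\tau)$ consists of a finite set $D$ (the arc set) and permutations $\rho,\tau$ of $D$ generating a transitive group. Hypervertices are the orbits of $\langle\rho\rangle$, hyperedges the orbits of $\langle\tau\rangle$, and incidence is non-empty intersection. This gives the underlying hypergraph $\Gamma$ (a hyperedge is regarded as containing the hypervertices incident with it; a priori distinct hyperedges may contain the same hypervertices). A hypermap is an embedding of the Levi graph of $\Gamma$ (the bipartite graph on hypervertices and hyperedges, with an edge for each incident pair), so $D$ is identified with the set of incident pairs (hypervertex, hyperedge); in particular each $\langle\rho\rangle$-orbit and each $\langle\tau\rangle$-orbit share at most one element of $D$. $\Gamma$ is simple if no hyperedge is contained, as a set of hypervertices, in another hyperedge (in particular, no two distinct hyperedges have the same hypervertices). An isomorphism $(D;\rho,\tau)\to(D';\rho',\tau')$ is a bijection $\psi:D\to D'$ with $\rho\psi=\psi\rho'$ and $\tau\psi=\psi\tau'$; $\mathrm{Aut}(\mathcal{M})$ is the group of isomorphisms $\mathcal{M}\to\mathcal{M}$. An automorphism $\sigma$ acts on hypervertices by $(\alpha^{\langle\rho\rangle})\mapsto(\alpha^{\sigma})^{\langle\rho\rangle}$.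 Cayley hypermaps. Let $G$ be a group. Subsets $\mathbf{x},\mathbf{y}$ of $G$ containing $1_G$ are Cayley equivalent if $\mathbf{x}g^{-1}=\mathbf{y}$ for some $g\in\mathbf{x}$. A set $Y=\{\mathbf{y}_1,\ldots,\mathbf{y}_r\}$ of subsets of $G$ containing $1_G$ is a non-Cayley equivalent hyperset if no two different elements of $Y$ are Cayley equivalent. Put $[Y]=\{\mathbf{y}g^{-1} : \mathbf{y}\in Y, g\in\mathbf{y}\}=\{\mathbf{x}_1,\ldots,\mathbf{x}_d\}$, $d=|[Y]|$. $\mathrm{CH}(G,Y)$ is the hypergraph with vertex set $G$ and edge set $\{\mathbf{y}g : \mathbf{y}\in Y, g\in G\}$; it is assumed connected, i.e. $G=\langle\bigcup_{\mathbf{y}\in Y}\mathbf{y}\rangle$. Its arc set is $D=\{(g,\mathbf{x}g) : g\in G,\mathbf{x}\in[Y]\}=\{(ah,\mathbf{y}_jh) : j\in[r], a\in\mathbf{y}_j, h\in G\}$. A cycle on $\mathbf{y}$ is a cyclic permutation $\tau=(a_1,\ldots,a_m)$ of all elements of $\mathbf{y}$; for $g\in G$, $\tau_g=(a_1g,\ldots,a_mg)$ on $\mathbf{y}g$; $\tau$ is ideal if $\tau_g=\tau$ for all $g$ with $\mathbf{y}g=\mathbf{y}$. Given a cyclic permutation $\rho_{[Y]}$ of all elements of $[Y]$ and ideal cycles $\tau_i$ on $\mathbf{y}_i$, $\tau_{[r]}=\{\tau_i : i\in[r]\}$, the Cayley hypermap $\mathrm{CM}(G,Y,\rho_{[Y]},\tau_{[r]})$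 is $(D;\rho,\tau)$ with $(g,\mathbf{x}g)^\rho=(g,\mathbf{x}^{\rho_{[Y]}}g)$ and $(ah,\mathbf{y}_jh)^\tau=(a^{\tau_j}h,\mathbf{y}_jh)$ for $a\in\mathbf{y}_j$, $h\in G$. *)

theory Defs
  imports
    "HOL-Combinatorics.Orbits"
    "HOL-Combinatorics.Permutations"
    "HOL-Algebra.Generated_Groups"
begin

section \<open>Oriented hypermaps\<close>

record 'a hypermap =
  arcs :: "'a set"
  vperm :: "'a \<Rightarrow> 'a"
  eperm :: "'a \<Rightarrow> 'a"

text \<open>
  Permutations act on the right, so the product of \<open>p\<close> and \<open>q\<close> is ``first \<open>p\<close>, then \<open>q\<close>''.
\<close>
definition perm_group :: "'a set \<Rightarrow> ('a \<Rightarrow> 'a) monoid" where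
  "perm_group D = \<lparr>carrier = {p. p permutes D}, mult = (\<lambda>p q. q \<circ> p), one = id\<rparr>"

definition hypervertices :: "'a hypermap \<Rightarrow> 'a set set" where
  "hypervertices M = orbit (vperm M) ` arcs M"

definition hyperedges :: "'a hypermap \<Rightarrow> 'a set set" where
  "hyperedges M = orbit (eperm M) ` arcs M"

text \<open>
  The last conjunct expresses that the arcs are identified with the incident pairs
  (hypervertex, hyperedge).  A transitive group is understood to act on a nonempty set.
\<close>
definition oriented_hypermap :: "'a hypermap \<Rightarrow> bool" where
  "oriented_hypermap M \<longleftrightarrow>
     finite (arcs M) \<and> arcs M \<noteq> {} \<and>
     vperm M permutes arcs M \<and> eperm M permutes arcs M \<and>
     (\<forall>\<alpha>\<in>arcs M. \<forall>\<beta>\<in>arcs M.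
        \<exists>\<pi>\<in>generate (perm_group (arcs M)) {vperm M, eperm M}. \<pi> \<alpha> = \<beta>) \<and>
     (\<forall>v\<in>hypervertices M. \<forall>e\<in>hyperedges M. card (v \<inter> e) \<le> 1)"

definition incident_hypervertices :: "'a hypermap \<Rightarrow> 'a set \<Rightarrow> 'a set set" where
  "incident_hypervertices M e = {v \<in> hypervertices M. v \<inter> e \<noteq> {}}"

definition simple_underlying :: "'a hypermap \<Rightarrow> bool" where
  "simple_underlying M \<longleftrightarrow>
     (\<forall>e\<in>hyperedges M. \<forall>e'\<in>hyperedges M. e \<noteq> e' \<longrightarrow>
        \<not> incident_hypervertices M e \<subseteq> incident_hypervertices M e')"

definition hypermap_iso :: "'a hypermap \<Rightarrow> 'b hypermap \<Rightarrow> ('a \<Rightarrow> 'b) \<Rightarrow> bool" where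
  "hypermap_iso M M' \<psi> \<longleftrightarrow>
     bij_betw \<psi> (arcs M) (arcs M') \<and>
     (\<forall>\<alpha>\<in>arcs M. \<psi> (vperm M \<alpha>) = vperm M' (\<psi> \<alpha>)) \<and>
     (\<forall>\<alpha>\<in>arcs M. \<psi> (eperm M \<alpha>) = eperm M' (\<psi> \<alpha>))"

text \<open>
  The condition \<open>\<sigma> permutes arcs M\<close> fixes \<open>\<sigma>\<close> to be the identity outside the arc set, so that
  every automorphism is represented by exactly one function.
\<close>
definition aut_group :: "'a hypermap \<Rightarrow> ('a \<Rightarrow> 'a) monoid" where
  "aut_group M = (perm_group (arcs M))
     \<lparr>carrier := {\<sigma>. \<sigma> permutes arcs M \<and> hypermap_iso M M \<sigma>}\<rparr>"

text \<open>
  The image of the hypervertex \<open>v\<close> under an automorphism \<open>\<sigma>\<close>: the orbit of \<open>\<sigma> \<alpha>\<close>, which is the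
  same for all arcs \<open>\<alpha>\<close> in \<open>v\<close>.
\<close>
definition hypervertex_act :: "'a hypermap \<Rightarrow> ('a \<Rightarrow> 'a) \<Rightarrow> 'a set \<Rightarrow> 'a set" where
  "hypervertex_act M \<sigma> v = (\<Union>\<alpha>\<in>v. orbit (vperm M) (\<sigma> \<alpha>))"

text \<open>Regular means transitive with trivial point stabilisers.\<close>
definition regular_on_hypervertices :: "'a hypermap \<Rightarrow> ('a \<Rightarrow> 'a) set \<Rightarrow> bool" where
  "regular_on_hypervertices M H \<longleftrightarrow>
     (\<forall>u\<in>hypervertices M. \<forall>v\<in>hypervertices M. \<exists>\<sigma>\<in>H. hypervertex_act M \<sigma> u = v) \<and>
     (\<forall>u\<in>hypervertices M. \<forall>\<sigma>\<in>H. hypervertex_act M \<sigma> u = u \<longrightarrow> \<sigma> = id)"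


section \<open>Cayley hypermaps\<close>

definition cayley_equivalent :: "('g, 'b) monoid_scheme \<Rightarrow> 'g set \<Rightarrow> 'g set \<Rightarrow> bool" where
  "cayley_equivalent G x y \<longleftrightarrow> (\<exists>g\<in>x. x #>\<^bsub>G\<^esub> inv\<^bsub>G\<^esub> g = y)"

definition non_cayley_equivalent_hyperset ::
    "('g, 'b) monoid_scheme \<Rightarrow> 'g set set \<Rightarrow> bool" where
  "non_cayley_equivalent_hyperset G Y \<longleftrightarrow>
     (\<forall>y\<in>Y. y \<subseteq> carrier G \<and> \<one>\<^bsub>G\<^esub> \<in> y) \<and>
     (\<forall>y\<in>Y. \<forall>y'\<in>Y. y \<noteq> y' \<longrightarrow> \<not> cayley_equivalent G y y')"

definition hyperset_closure :: "('g, 'b) monoid_scheme \<Rightarrow> 'g set set \<Rightarrow> 'g set set" where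
  "hyperset_closure G Y = {y #>\<^bsub>G\<^esub> inv\<^bsub>G\<^esub> g | y g. y \<in> Y \<and> g \<in> y}"

definition cycle_on :: "'c set \<Rightarrow> ('c \<Rightarrow> 'c) \<Rightarrow> bool" where
  "cycle_on S \<sigma> \<longleftrightarrow> \<sigma> permutes S \<and> cyclic_on \<sigma> S"

text \<open>
  For a cycle \<open>\<tau> = (a\<^sub>1, \<dots>, a\<^sub>m)\<close> on \<open>y\<close>, the permutation \<open>map_permutation y (\<lambda>a. a \<otimes> g) \<tau>\<close>
  is the cycle \<open>(a\<^sub>1 g, \<dots>, a\<^sub>m g)\<close> on \<open>y #> g\<close>.
\<close>
definition ideal_cycle ::
    "('g, 'b) monoid_scheme \<Rightarrow> 'g set \<Rightarrow> ('g \<Rightarrow> 'g) \<Rightarrow> bool" where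
  "ideal_cycle G y \<tau> \<longleftrightarrow>
     cycle_on y \<tau> \<and>
     (\<forall>g\<in>carrier G. y #>\<^bsub>G\<^esub> g = y \<longrightarrow> map_permutation y (\<lambda>a. a \<otimes>\<^bsub>G\<^esub> g) \<tau> = \<tau>)"

text \<open>
  The cycles \<open>\<tau>\<^sub>i\<close> are indexed by the elements of \<open>Y\<close> themselves: \<open>\<tau> y\<close> is the cycle on \<open>y\<close>.
\<close>
definition cayley_hypermap_data ::
    "('g, 'b) monoid_scheme \<Rightarrow> 'g set set \<Rightarrow> ('g set \<Rightarrow> 'g set) \<Rightarrow> ('g set \<Rightarrow> 'g \<Rightarrow> 'g) \<Rightarrow> bool" where
  "cayley_hypermap_data G Y \<rho> \<tau> \<longleftrightarrow>
     group G \<and> finite (carrier G) \<and>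
     non_cayley_equivalent_hyperset G Y \<and>
     generate G (\<Union>Y) = carrier G \<and>
     cycle_on (hyperset_closure G Y) \<rho> \<and>
     (\<forall>y\<in>Y. ideal_cycle G y (\<tau> y))"

definition CM_arcs :: "('g, 'b) monoid_scheme \<Rightarrow> 'g set set \<Rightarrow> ('g \<times> 'g set) set" where
  "CM_arcs G Y = {(g, x #>\<^bsub>G\<^esub> g) | g x. g \<in> carrier G \<and> x \<in> hyperset_closure G Y}"

text \<open>
  The descriptions below are well defined for \<^const>\<open>cayley_hypermap_data\<close>; see the lemmas
  \<open>CM_vperm\<close> and \<open>CM_eperm\<close>.
\<close>
definition CM ::
    "('g, 'b) monoid_scheme \<Rightarrow> 'g set set \<Rightarrow> ('g set \<Rightarrow> 'g set) \<Rightarrow> ('g set \<Rightarrow> 'g \<Rightarrow> 'g)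
      \<Rightarrow> ('g \<times> 'g set) hypermap" where
  "CM G Y \<rho> \<tau> =
     \<lparr>arcs = CM_arcs G Y,
      vperm = (\<lambda>\<alpha>. if \<alpha> \<in> CM_arcs G Y
         then THE \<beta>. \<exists>g\<in>carrier G. \<exists>x\<in>hyperset_closure G Y.
                \<alpha> = (g, x #>\<^bsub>G\<^esub> g) \<and> \<beta> = (g, \<rho> x #>\<^bsub>G\<^esub> g)
         else \<alpha>),
      eperm = (\<lambda>\<alpha>. if \<alpha> \<in> CM_arcs G Y
         then THE \<beta>. \<exists>y\<in>Y. \<exists>a\<in>y. \<exists>h\<in>carrier G.
                \<alpha> = (a \<otimes>\<^bsub>G\<^esub> h, y #>\<^bsub>G\<^esub> h) \<and> \<beta> = (\<tau> y a \<otimes>\<^bsub>G\<^esub> h, y #>\<^bsub>G\<^esub> h)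
         else \<alpha>)\<rparr>"

text \<open>
  Every finite group is isomorphic to one whose elements are natural numbers, so letting \<open>G\<close>
  range over groups of type \<^typ>\<open>nat monoid\<close> covers all finite groups; the lemma
  \<open>is_cayley_hypermapI\<close> makes this precise.
\<close>
definition is_cayley_hypermap :: "'a hypermap \<Rightarrow> bool" where
  "is_cayley_hypermap M \<longleftrightarrow>
     (\<exists>(G :: nat monoid) Y \<rho> \<tau> \<psi>.
        cayley_hypermap_data G Y \<rho> \<tau> \<and> hypermap_iso M (CM G Y \<rho> \<tau>) \<psi>)"


subsection \<open>Well-definedness of the permutations of a Cayley hypermap\<close>

context
  fixes G :: "('g, 'b) monoid_scheme" (structure) and Y \<rho> \<tau>
  assumes data: "cayley_hypermap_data G Y \<rho> \<tau>"
begin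

interpretation group G
  using data by (simp add: cayley_hypermap_data_def)

lemma hyperset_subset: "y \<in> Y \<Longrightarrow> y \<subseteq> carrier G"
  and hyperset_one: "y \<in> Y \<Longrightarrow> \<one> \<in> y"
  using data by (auto simp: cayley_hypermap_data_def non_cayley_equivalent_hyperset_def)

lemma hyperset_closure_subset: "x \<in> hyperset_closure G Y \<Longrightarrow> x \<subseteq> carrier G"
proof -
  assume "x \<in> hyperset_closure G Y"
  then obtain y g where "y \<in> Y" "g \<in> y" "x = y #> inv g" by (auto simp: hyperset_closure_def)
  then show "x \<subseteq> carrier G"
    using hyperset_subset[of y] r_coset_subset_G[of y "inv g"] by auto
qed

lemma r_coset_cancel:
  assumes "x \<subseteq> carrier G" "x' \<subseteq> carrier G" "g \<in> carrier G" "x #> g = x' #> g"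
  shows "x = x'"
proof -
  have "(x #> g) #> inv g = (x' #> g) #> inv g" using assms by simp
  then show ?thesis
    using assms(1-3) coset_mult_assoc[of x g "inv g"] coset_mult_assoc[of x' g "inv g"] by simp
qed

lemma CM_arcs_altdef:
  "CM_arcs G Y = {(a \<otimes> h, y #> h) | y a h. y \<in> Y \<and> a \<in> y \<and> h \<in> carrier G}"
proof (intro equalityI subsetI)
  fix p assume "p \<in> CM_arcs G Y"
  then obtain g y a where *: "g \<in> carrier G" "y \<in> Y" "a \<in> y" "p = (g, (y #> inv a) #> g)"
    by (auto simp: CM_arcs_def hyperset_closure_def)
  have a: "a \<in> carrier G" using * hyperset_subset by auto
  have "p = (a \<otimes> (inv a \<otimes> g), y #> (inv a \<otimes> g))"
    using * a hyperset_subset[of y] by (simp add: coset_mult_assoc flip: m_assoc)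
  then show "p \<in> {(a \<otimes> h, y #> h) | y a h. y \<in> Y \<and> a \<in> y \<and> h \<in> carrier G}"
    using * a by blast
next
  fix p assume "p \<in> {(a \<otimes> h, y #> h) | y a h. y \<in> Y \<and> a \<in> y \<and> h \<in> carrier G}"
  then obtain y a h where *: "y \<in> Y" "a \<in> y" "h \<in> carrier G" "p = (a \<otimes> h, y #> h)"
    by auto
  have a: "a \<in> carrier G" using * hyperset_subset by auto
  have "p = (a \<otimes> h, (y #> inv a) #> (a \<otimes> h))"
    using * a hyperset_subset[of y] by (simp add: coset_mult_assoc flip: m_assoc)
  moreover have "y #> inv a \<in> hyperset_closure G Y" using * by (auto simp: hyperset_closure_def)
  ultimately show "p \<in> CM_arcs G Y" using * a unfolding CM_arcs_def by blast
qed

lemma CM_vperm: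
  assumes "g \<in> carrier G" "x \<in> hyperset_closure G Y"
  shows "vperm (CM G Y \<rho> \<tau>) (g, x #> g) = (g, \<rho> x #> g)"
proof -
  have "(g, x #> g) \<in> CM_arcs G Y" using assms by (auto simp: CM_arcs_def)
  moreover have "(THE \<beta>. \<exists>g'\<in>carrier G. \<exists>x'\<in>hyperset_closure G Y.
      (g, x #> g) = (g', x' #> g') \<and> \<beta> = (g', \<rho> x' #> g')) = (g, \<rho> x #> g)"
    using assms r_coset_cancel[OF hyperset_closure_subset hyperset_closure_subset, of _ _ g]
    by (intro the_equality) blast+
  ultimately show ?thesis by (simp add: CM_def)
qed

lemma CM_eperm:
  assumes "y \<in> Y" "a \<in> y" "h \<in> carrier G"
  shows "eperm (CM G Y \<rho> \<tau>) (a \<otimes> h, y #> h) = (\<tau> y a \<otimes> h, y #> h)"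
proof -
  have unique: "\<tau> y' a' \<otimes> h' = \<tau> y a \<otimes> h"
    if *: "y' \<in> Y" "a' \<in> y'" "h' \<in> carrier G" "a' \<otimes> h' = a \<otimes> h" "y' #> h' = y #> h"
    for y' a' h'
  proof -
    define k where "k = h \<otimes> inv h'"
    have k: "k \<in> carrier G" using * assms by (simp add: k_def)
    have sub: "y \<subseteq> carrier G" "y' \<subseteq> carrier G" using * assms hyperset_subset by auto
    then have a: "a \<in> carrier G" "a' \<in> carrier G" using * assms by auto
    have "(y' #> h') #> inv h' = (y #> h) #> inv h'" using * by simp
    then have y': "y' = y #> k"
      using *(3) assms(3) sub coset_mult_assoc[of y' h' "inv h'"] coset_mult_assoc[of y h "inv h'"]
      by (simp add: k_def)
    have "(a' \<otimes> h') \<otimes> inv h' = (a \<otimes> h) \<otimes> inv h'" using * by simp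
    then have a': "a' = a \<otimes> k"
      using *(3) assms(3) a m_assoc[of a' h' "inv h'"] m_assoc[of a h "inv h'"]
      by (simp add: k_def)
    have "\<one> \<in> y #> k" using y' * hyperset_one by auto
    then obtain b where b: "b \<in> y" "\<one> = b \<otimes> k" by (auto simp: r_coset_def)
    then have "k = inv b" using sub k inv_equality[of b k] by (metis inv_inv subsetD inv_equality)
    then have "cayley_equivalent G y y'" using b y' by (auto simp: cayley_equivalent_def)
    then have yy: "y = y'"
      using data * assms by (auto simp: cayley_hypermap_data_def non_cayley_equivalent_hyperset_def)
    have ideal: "ideal_cycle G y (\<tau> y)" using data assms by (auto simp: cayley_hypermap_data_def)
    then have perm: "\<tau> y permutes y" by (simp add: ideal_cycle_def cycle_on_def)
    have inj: "inj_on (\<lambda>a. a \<otimes> k) y" 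
      using sub k by (intro inj_onI) (metis right_cancel subsetD)
    have "map_permutation y (\<lambda>a. a \<otimes> k) (\<tau> y) (a \<otimes> k) = \<tau> y a \<otimes> k"
      using assms inv_into_f_f[OF inj, of a] by (simp add: map_permutation_def)
    moreover have "map_permutation y (\<lambda>a. a \<otimes> k) (\<tau> y) = \<tau> y"
      using ideal k y'[folded yy] unfolding ideal_cycle_def by metis
    ultimately have "\<tau> y' a' = \<tau> y a \<otimes> k" using yy a' by simp
    moreover have "\<tau> y a \<in> carrier G" using perm assms sub by (auto simp: permutes_in_image)
    ultimately show ?thesis using * assms by (simp add: m_assoc k_def)
  qed
  have "(a \<otimes> h, y #> h) \<in> CM_arcs G Y" using assms by (auto simp: CM_arcs_altdef)
  moreover have "(THE \<beta>. \<exists>y'\<in>Y. \<exists>a'\<in>y'. \<exists>h'\<in>carrier G.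
      (a \<otimes> h, y #> h) = (a' \<otimes> h', y' #> h') \<and> \<beta> = (\<tau> y' a' \<otimes> h', y' #> h'))
      = (\<tau> y a \<otimes> h, y #> h)"
  proof (intro the_equality)
    show "\<exists>y'\<in>Y. \<exists>a'\<in>y'. \<exists>h'\<in>carrier G. (a \<otimes> h, y #> h) = (a' \<otimes> h', y' #> h') \<and>
        (\<tau> y a \<otimes> h, y #> h) = (\<tau> y' a' \<otimes> h', y' #> h')"
      using assms by blast
  next
    fix \<beta> assume "\<exists>y'\<in>Y. \<exists>a'\<in>y'. \<exists>h'\<in>carrier G.
      (a \<otimes> h, y #> h) = (a' \<otimes> h', y' #> h') \<and> \<beta> = (\<tau> y' a' \<otimes> h', y' #> h')"
    then obtain y' a' h' where "y' \<in> Y" "a' \<in> y'" "h' \<in> carrier G"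
      "a' \<otimes> h' = a \<otimes> h" "y' #> h' = y #> h" "\<beta> = (\<tau> y' a' \<otimes> h', y' #> h')"
      by auto
    then show "\<beta> = (\<tau> y a \<otimes> h, y #> h)" using unique[of y' a' h'] by simp
  qed
  ultimately show ?thesis by (simp add: CM_def)
qed

end


subsection \<open>Independence of the type of group elements\<close>

lemma cycle_on_map_permutation:
  assumes "cycle_on S p" "inj_on f S"
  shows "cycle_on (f ` S) (map_permutation S f p)"
proof -
  let ?q = "map_permutation S f p"
  have p: "p permutes S" and "cyclic_on p S" using assms by (auto simp: cycle_on_def)
  then obtain s where s: "s \<in> S" "S = orbit p s" by (auto simp: cyclic_on_def)
  have q: "?q (f x) = f (p x)" if "x \<in> S" for x
    using that assms by (simp add: map_permutation_def)
  have "f x \<in> orbit ?q (f s)" if "x \<in> orbit p s" for x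
    using that
  proof induction
    case base
    then show ?case using q[OF s(1)] orbit.base[of ?q "f s"] by simp
  next
    case (step x)
    then show ?case using q[of x] s(2) orbit.step[of "f x" ?q "f s"] by simp
  qed
  moreover have "z \<in> f ` S" if "z \<in> orbit ?q (f s)" for z
    using that by induction (use q s p in \<open>auto simp: permutes_in_image\<close>)
  ultimately have "f ` S = orbit ?q (f s)" using s(2) by blast
  moreover have "?q permutes f ` S"
    using assms p by (intro map_permutation_permutes) (auto simp: bij_betw_def)
  ultimately show ?thesis using s by (auto simp: cycle_on_def cyclic_on_def)
qed

lemma CM_iso_transfer:
  fixes G :: "('g, 'b) monoid_scheme" and G' :: "('h, 'c) monoid_scheme"
  assumes data: "cayley_hypermap_data G Y \<rho> \<tau>" and "group G'" and iso: "f \<in> iso G G'"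
  shows "\<exists>Y' \<rho>' \<tau>' \<psi>. cayley_hypermap_data G' Y' \<rho>' \<tau>' \<and>
           hypermap_iso (CM G Y \<rho> \<tau>) (CM G' Y' \<rho>' \<tau>') \<psi>"
proof -
  interpret G: group G using data by (simp add: cayley_hypermap_data_def)
  interpret G': group G' by fact
  interpret group_hom G G' f
    using iso by unfold_locales (auto simp: iso_def)
  have inj: "inj_on f (carrier G)" and surj: "f ` carrier G = carrier G'"
    using iso by (auto simp: iso_def bij_betw_def)
  let ?F = "image f"
  have injF: "inj_on ?F (Pow (carrier G))" using inj by (rule inj_on_image_Pow)
  have injS: "inj_on f S" if "S \<subseteq> carrier G" for S using inj that by (rule inj_on_subset)
  note Ysub = hyperset_subset[OF data]
  note Csub = hyperset_closure_subset[OF data]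
  have coset: "f ` (S #>\<^bsub>G\<^esub> g) = f ` S #>\<^bsub>G'\<^esub> f g" if "S \<subseteq> carrier G" "g \<in> carrier G" for S g
    using that by (auto simp: r_coset_def image_iff subset_iff intro!: bexI)
  define Y' where "Y' = ?F ` Y"
  define \<rho>' where "\<rho>' = map_permutation (hyperset_closure G Y) ?F \<rho>"
  define pre where "pre = inv_into Y ?F"
  define \<tau>' where "\<tau>' = (\<lambda>y'. map_permutation (pre y') f (\<tau> (pre y')))"
  define \<psi> where "\<psi> = (\<lambda>(g, e). (f g, f ` e))"
  have pre: "pre (f ` y) = y" if "y \<in> Y" for y
    unfolding pre_def using that Ysub injF by (intro inv_into_f_f) (auto intro: inj_on_subset)
  have C': "hyperset_closure G' Y' = ?F ` hyperset_closure G Y"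
  proof -
    have eq: "f ` (y #>\<^bsub>G\<^esub> inv\<^bsub>G\<^esub> g) = f ` y #>\<^bsub>G'\<^esub> inv\<^bsub>G'\<^esub> f g" if "y \<in> Y" "g \<in> y" for y g
    proof -
      have "g \<in> carrier G" "y \<subseteq> carrier G" using that Ysub by auto
      then show ?thesis by (simp add: coset hom_inv)
    qed
    show ?thesis
    proof (intro equalityI subsetI)
      fix z assume "z \<in> hyperset_closure G' Y'"
      then obtain y g where "y \<in> Y" "g \<in> y" "z = f ` y #>\<^bsub>G'\<^esub> inv\<^bsub>G'\<^esub> f g"
        unfolding hyperset_closure_def Y'_def by blast
      then show "z \<in> ?F ` hyperset_closure G Y"
        using eq[of y g] unfolding hyperset_closure_def by blast
    next
      fix z assume "z \<in> ?F ` hyperset_closure G Y"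
      then obtain y g where "y \<in> Y" "g \<in> y" "z = f ` (y #>\<^bsub>G\<^esub> inv\<^bsub>G\<^esub> g)"
        unfolding hyperset_closure_def by blast
      then have "f ` y \<in> Y'" "f g \<in> f ` y" "z = f ` y #>\<^bsub>G'\<^esub> inv\<^bsub>G'\<^esub> f g"
        using eq[of y g] by (auto simp: Y'_def)
      then show "z \<in> hyperset_closure G' Y'" unfolding hyperset_closure_def by blast
    qed
  qed
  have \<rho>: "cycle_on (hyperset_closure G Y) \<rho>" using data by (simp add: cayley_hypermap_data_def)
  then have \<rho>_in: "\<rho> x \<in> hyperset_closure G Y" if "x \<in> hyperset_closure G Y" for x
    using that by (simp add: cycle_on_def permutes_in_image)
  have \<tau>: "ideal_cycle G y (\<tau> y)" if "y \<in> Y" for y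
    using data that by (simp add: cayley_hypermap_data_def)
  then have \<tau>c: "cycle_on y (\<tau> y)" if "y \<in> Y" for y using that by (simp add: ideal_cycle_def)
  then have \<tau>_in: "\<tau> y a \<in> y" if "y \<in> Y" "a \<in> y" for y a
    using that by (simp add: cycle_on_def permutes_in_image)
  have injC: "inj_on ?F (hyperset_closure G Y)" using Csub injF by (auto intro: inj_on_subset)
  have \<rho>': "\<rho>' (f ` x) = f ` \<rho> x" if "x \<in> hyperset_closure G Y" for x
    using that injC by (simp add: \<rho>'_def map_permutation_def)
  have \<tau>': "\<tau>' (f ` y) (f a) = f (\<tau> y a)" if "y \<in> Y" "a \<in> y" for y a
    using that injS[OF Ysub] by (simp add: \<tau>'_def pre map_permutation_def)
  have nce: "non_cayley_equivalent_hyperset G' Y'"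
    unfolding non_cayley_equivalent_hyperset_def
  proof (intro conjI ballI impI)
    fix y' assume "y' \<in> Y'"
    then obtain y where y: "y \<in> Y" "y' = f ` y" by (auto simp: Y'_def)
    show "y' \<subseteq> carrier G'" using y Ysub[of y] surj by blast
    show "\<one>\<^bsub>G'\<^esub> \<in> y'" using y hyperset_one[OF data, of y] hom_one by (metis imageI)
  next
    fix y1' y2' assume as: "y1' \<in> Y'" "y2' \<in> Y'" "y1' \<noteq> y2'"
    then obtain y1 y2 where y: "y1 \<in> Y" "y1' = f ` y1" "y2 \<in> Y" "y2' = f ` y2"
      by (auto simp: Y'_def)
    show "\<not> cayley_equivalent G' y1' y2'"
    proof
      assume "cayley_equivalent G' y1' y2'"
      then obtain g where g: "g \<in> y1" "f ` y1 #>\<^bsub>G'\<^esub> inv\<^bsub>G'\<^esub> f g = f ` y2"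
        using y by (auto simp: cayley_equivalent_def)
      have gc: "g \<in> carrier G" using g y Ysub by auto
      then have "f ` (y1 #>\<^bsub>G\<^esub> inv\<^bsub>G\<^esub> g) = f ` y2"
        using g y Ysub[of y1] by (simp add: coset hom_inv)
      then have "y1 #>\<^bsub>G\<^esub> inv\<^bsub>G\<^esub> g = y2"
        using gc y Ysub[of y1] Ysub[of y2] G.r_coset_subset_G[of y1 "inv\<^bsub>G\<^esub> g"]
        by (intro inj_onD[OF injF]) auto
      then have "cayley_equivalent G y1 y2" using g by (auto simp: cayley_equivalent_def)
      moreover have "y1 \<noteq> y2" using as y by auto
      ultimately show False
        using data y by (auto simp: cayley_hypermap_data_def non_cayley_equivalent_hyperset_def)
    qed
  qed
  have gen: "generate G' (\<Union>Y') = carrier G'"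
  proof -
    have "generate G' (f ` \<Union>Y) = f ` generate G (\<Union>Y)"
      using Ysub by (subst generate_img) auto
    also have "f ` \<Union>Y = \<Union>Y'" by (auto simp: Y'_def)
    finally show ?thesis using data surj by (simp add: cayley_hypermap_data_def)
  qed
  have ideal: "ideal_cycle G' y' (\<tau>' y')" if "y' \<in> Y'" for y'
  proof -
    obtain y where y: "y \<in> Y" "y' = f ` y" using \<open>y' \<in> Y'\<close> by (auto simp: Y'_def)
    note ysub = Ysub[OF y(1)]
    have t': "\<tau>' y' = map_permutation y f (\<tau> y)" using y by (simp add: \<tau>'_def pre)
    have cyc: "cycle_on y' (\<tau>' y')"
      unfolding t' using y \<tau>c injS[OF ysub] by (simp add: cycle_on_map_permutation)
    show ?thesis unfolding ideal_cycle_def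
    proof (intro conjI ballI impI cyc)
      fix g' assume g': "g' \<in> carrier G'" "y' #>\<^bsub>G'\<^esub> g' = y'"
      then obtain g where g: "g \<in> carrier G" "g' = f g" using surj by auto
      have "f ` (y #>\<^bsub>G\<^esub> g) = f ` y" using g g' y ysub by (simp add: coset)
      then have yg: "y #>\<^bsub>G\<^esub> g = y"
        using g ysub G.r_coset_subset_G[of y g] by (intro inj_onD[OF injF]) auto
      let ?r = "\<lambda>a. a \<otimes>\<^bsub>G\<^esub> g" and ?r' = "\<lambda>a. a \<otimes>\<^bsub>G'\<^esub> g'"
      have bij: "bij_betw ?r y y"
        unfolding bij_betw_def
      proof
        show "inj_on ?r y" using g ysub by (intro inj_onI) (metis G.right_cancel subsetD)
        show "?r ` y = y" using yg by (auto simp: r_coset_def)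
      qed
      have inv: "map_permutation y ?r (\<tau> y) = \<tau> y"
        using \<tau>[OF y(1)] g yg by (auto simp: ideal_cycle_def)
      have bijf: "bij_betw f y y'" using y injS[OF ysub] by (simp add: bij_betw_def)
      have ysub': "y' \<subseteq> carrier G'" using y ysub surj by auto
      have inj': "inj_on ?r' y'" 
        using g' ysub' by (intro inj_onI) (metis G'.right_cancel subsetD)
      have comm: "f (a \<otimes>\<^bsub>G\<^esub> g) = f a \<otimes>\<^bsub>G'\<^esub> g'" if "a \<in> y" for a
        using that g ysub by auto
      have "map_permutation y' ?r' (\<tau>' y') = map_permutation y (?r' \<circ> f) (\<tau> y)"
        unfolding t' using bijf inj' by (rule map_permutation_compose)
      also have "\<dots> = map_permutation y (f \<circ> ?r) (\<tau> y)"
        using y \<tau>c[OF y(1)] comm bijf inj'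
        by (intro map_permutation_cong) (auto simp: cycle_on_def bij_betw_def intro!: comp_inj_on)
      also have "\<dots> = map_permutation y f (map_permutation y ?r (\<tau> y))"
        using bij injS[OF ysub] by (rule map_permutation_compose[symmetric])
      finally show "map_permutation y' ?r' (\<tau>' y') = \<tau>' y'" by (simp add: inv t')
    qed
  qed
  have data': "cayley_hypermap_data G' Y' \<rho>' \<tau>'"
    unfolding cayley_hypermap_data_def
  proof (intro conjI ballI nce gen ideal \<open>group G'\<close>)
    have "finite (carrier G)" using data by (simp add: cayley_hypermap_data_def)
    then show "finite (carrier G')" using surj by (metis finite_imageI)
    show "cycle_on (hyperset_closure G' Y') \<rho>'"
      unfolding C' \<rho>'_def using \<rho> injC by (rule cycle_on_map_permutation)
  qed
  have "hypermap_iso (CM G Y \<rho> \<tau>) (CM G' Y' \<rho>' \<tau>') \<psi>"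
    unfolding hypermap_iso_def
  proof (intro conjI ballI)
    have arcs: "arcs (CM G Y \<rho> \<tau>) = CM_arcs G Y" "arcs (CM G' Y' \<rho>' \<tau>') = CM_arcs G' Y'"
      by (auto simp: CM_def)
    have "CM_arcs G Y \<subseteq> carrier G \<times> Pow (carrier G)"
    proof
      fix z assume "z \<in> CM_arcs G Y"
      then obtain g x where "g \<in> carrier G" "x \<in> hyperset_closure G Y" "z = (g, x #>\<^bsub>G\<^esub> g)"
        by (auto simp: CM_arcs_def)
      then show "z \<in> carrier G \<times> Pow (carrier G)"
        using G.r_coset_subset_G[OF Csub, of x g] by simp
    qed
    moreover have "inj_on \<psi> (carrier G \<times> Pow (carrier G))"
      using map_prod_inj_on[OF inj injF] by (simp add: \<psi>_def map_prod_def)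
    ultimately have "inj_on \<psi> (CM_arcs G Y)" by (rule inj_on_subset[rotated])
    moreover have "\<psi> ` CM_arcs G Y = CM_arcs G' Y'"
    proof (intro equalityI subsetI)
      fix z assume "z \<in> \<psi> ` CM_arcs G Y"
      then obtain g x where gx: "g \<in> carrier G" "x \<in> hyperset_closure G Y" "z = \<psi> (g, x #>\<^bsub>G\<^esub> g)"
        by (auto simp: CM_arcs_def)
      then have "z = (f g, f ` x #>\<^bsub>G'\<^esub> f g)" using Csub by (simp add: \<psi>_def coset)
      then show "z \<in> CM_arcs G' Y'" using gx surj unfolding CM_arcs_def C' by blast
    next
      fix z assume "z \<in> CM_arcs G' Y'"
      then obtain g x where gx: "g \<in> carrier G" "x \<in> hyperset_closure G Y"
        "z = (f g, f ` x #>\<^bsub>G'\<^esub> f g)"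
        by (auto simp: CM_arcs_def C' simp flip: surj)
      then have "z = \<psi> (g, x #>\<^bsub>G\<^esub> g)" using Csub by (simp add: \<psi>_def coset)
      then show "z \<in> \<psi> ` CM_arcs G Y" using gx unfolding CM_arcs_def by blast
    qed
    ultimately show "bij_betw \<psi> (arcs (CM G Y \<rho> \<tau>)) (arcs (CM G' Y' \<rho>' \<tau>'))"
      by (simp add: arcs bij_betw_def)
    fix \<alpha> assume \<alpha>: "\<alpha> \<in> arcs (CM G Y \<rho> \<tau>)"
    then obtain g x where gx: "g \<in> carrier G" "x \<in> hyperset_closure G Y" "\<alpha> = (g, x #>\<^bsub>G\<^esub> g)"
      unfolding arcs CM_arcs_def by blast
    have "\<psi> (vperm (CM G Y \<rho> \<tau>) \<alpha>) = (f g, f ` \<rho> x #>\<^bsub>G'\<^esub> f g)"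
      using gx Csub \<rho>_in by (simp add: CM_vperm[OF data] \<psi>_def coset)
    also have "\<dots> = (f g, \<rho>' (f ` x) #>\<^bsub>G'\<^esub> f g)"
      using gx by (simp add: \<rho>')
    also have "\<dots> = vperm (CM G' Y' \<rho>' \<tau>') (f g, f ` x #>\<^bsub>G'\<^esub> f g)"
      using gx surj by (intro CM_vperm[OF data', symmetric]) (auto simp: C')
    also have "(f g, f ` x #>\<^bsub>G'\<^esub> f g) = \<psi> \<alpha>" using gx Csub by (simp add: \<psi>_def coset)
    finally show "\<psi> (vperm (CM G Y \<rho> \<tau>) \<alpha>) = vperm (CM G' Y' \<rho>' \<tau>') (\<psi> \<alpha>)" .
    obtain y a h where yah: "y \<in> Y" "a \<in> y" "h \<in> carrier G" "\<alpha> = (a \<otimes>\<^bsub>G\<^esub> h, y #>\<^bsub>G\<^esub> h)"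
      using \<alpha> unfolding arcs CM_arcs_altdef[OF data] by blast
    have "a \<in> carrier G" "\<tau> y a \<in> carrier G" using yah Ysub[of y] \<tau>_in by auto
    note this [simp]
    have "\<psi> (eperm (CM G Y \<rho> \<tau>) \<alpha>) = (f (\<tau> y a) \<otimes>\<^bsub>G'\<^esub> f h, f ` y #>\<^bsub>G'\<^esub> f h)"
      using yah Ysub by (simp add: CM_eperm[OF data] \<psi>_def coset)
    also have "\<dots> = (\<tau>' (f ` y) (f a) \<otimes>\<^bsub>G'\<^esub> f h, f ` y #>\<^bsub>G'\<^esub> f h)"
      using yah by (simp add: \<tau>')
    also have "\<dots> = eperm (CM G' Y' \<rho>' \<tau>') (f a \<otimes>\<^bsub>G'\<^esub> f h, f ` y #>\<^bsub>G'\<^esub> f h)"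
      using yah surj by (intro CM_eperm[OF data', symmetric]) (auto simp: Y'_def)
    also have "(f a \<otimes>\<^bsub>G'\<^esub> f h, f ` y #>\<^bsub>G'\<^esub> f h) = \<psi> \<alpha>"
      using yah Ysub by (simp add: \<psi>_def coset)
    finally show "\<psi> (eperm (CM G Y \<rho> \<tau>) \<alpha>) = eperm (CM G' Y' \<rho>' \<tau>') (\<psi> \<alpha>)" .
  qed
  with data' show ?thesis by blast
qed

lemma hypermap_iso_trans:
  assumes "hypermap_iso M M' \<phi>" "hypermap_iso M' M'' \<psi>"
  shows "hypermap_iso M M'' (\<psi> \<circ> \<phi>)"
proof -
  have \<phi>: "bij_betw \<phi> (arcs M) (arcs M')" and \<psi>: "bij_betw \<psi> (arcs M') (arcs M'')"
    using assms by (simp_all add: hypermap_iso_def)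
  then have "\<phi> \<alpha> \<in> arcs M'" if "\<alpha> \<in> arcs M" for \<alpha>
    using that by (metis bij_betwE)
  with bij_betw_trans[OF \<phi> \<psi>] assms show ?thesis
    by (simp add: hypermap_iso_def)
qed

lemma is_cayley_hypermapI:
  fixes G :: "('g, 'b) monoid_scheme"
  assumes data: "cayley_hypermap_data G Y \<rho> \<tau>"
    and iso: "hypermap_iso M (CM G Y \<rho> \<tau>) \<phi>"
  shows "is_cayley_hypermap M"
proof -
  interpret group G using data by (simp add: cayley_hypermap_data_def)
  have "finite (carrier G)" using data by (simp add: cayley_hypermap_data_def)
  then obtain f :: "'g \<Rightarrow> nat" where inj: "inj_on f (carrier G)"
    using finite_imp_inj_to_nat_seg by blast
  define u where "u = inv_into (carrier G) f"
  have u [simp]: "u (f a) = a" if "a \<in> carrier G" for a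
    using that inj by (simp add: u_def)
  define G' :: "nat monoid" where
    "G' = \<lparr>carrier = f ` carrier G, mult = (\<lambda>m n. f (u m \<otimes>\<^bsub>G\<^esub> u n)), one = f \<one>\<^bsub>G\<^esub>\<rparr>"
  have "group G'"
    by (rule groupI) (auto simp: G'_def m_assoc intro!: bexI[of _ "inv\<^bsub>G\<^esub> _"])
  moreover have "f \<in> iso G G'"
    using inj by (auto simp: iso_def hom_def bij_betw_def G'_def)
  ultimately obtain Y' \<rho>' \<tau>' \<psi> where "cayley_hypermap_data G' Y' \<rho>' \<tau>'"
      "hypermap_iso (CM G Y \<rho> \<tau>) (CM G' Y' \<rho>' \<tau>') \<psi>"
    using CM_iso_transfer[OF data] by blast
  with hypermap_iso_trans[OF iso] show ?thesis
    unfolding is_cayley_hypermap_def by blast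
qed

end

theory Submission
  imports Defs
begin

text \<open>
  Fix a group \<open>G\<close> acting regularly on the hypervertices by automorphisms.  After the choice of a
  base hypervertex, every hypervertex is the image of the base under exactly one element of \<open>G\<close>,
  so each arc \<open>\<alpha>\<close> gets a label \<open>\<gamma> \<alpha>\<close> in \<open>G\<close>, the name of its hypervertex.  The labelling is
  equivariant for right multiplication, and its fibres are exactly the hypervertices.  Such a
  labelling (locale \<open>regular_labelling\<close>) is the notion through which both directions pass.

  A Cayley hypermap is labelled by its first coordinate, with \<open>G\<close> acting by right multiplication
  (\<open>regular_labelling_CM\<close>).  Labellings can be pulled back along isomorphisms, and the acting group
  of a labelling is, as a group of permutations of the arcs, a subgroup of the automorphism group
  that is regular on hypervertices (\<open>regular_subgroup_exists\<close>).

  Conversely, a regular subgroup gives a labelling by itself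
  (\<open>regular_labelling_of_regular_subgroup\<close>), and the hypermap is rebuilt from the labels
  (\<open>is_cayley_hypermap_if_simple\<close>).  A hyperedge becomes the set of labels of its arcs.
  Simplicity makes this set determine the hyperedge, and since a hypervertex and a hyperedge share
  at most one arc, an arc is determined by its label together with the label set of its
  hyperedge; this pair is its image in the Cayley hypermap.  The label sets of the hyperedges
  through the base hypervertex form a family \<open>C\<close> of subsets containing \<open>\<one>\<close> that is closed under
  \<open>x \<mapsto> x g\<^sup>-\<^sup>1\<close> for \<open>g \<in> x\<close>.  Hence \<open>C = [Y]\<close> for any set \<open>Y\<close> of representatives of the Cayley
  classes in \<open>C\<close> (\<open>hyperset_representatives\<close>).  The cycle on \<open>C\<close> is read off from the rotation at
  the base hypervertex, and the cycle on \<open>y \<in> Y\<close> from the rotation at the hyperedge with label set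
  \<open>y\<close>.  The latter is ideal because, again by simplicity, \<open>y g = y\<close> forces \<open>g\<close> to
  stabilise that hyperedge (\<open>ideal_edge_cycle\<close>).  Finally, consecutive arcs of a hyperedge
  have labels that differ by an element of some set in \<open>C\<close>, so transitivity of the hypermap yields
  that \<open>Y\<close> generates \<open>G\<close> (\<open>generate_eq_carrier_if_quotients\<close>).
\<close>

section \<open>Oriented hypermaps and their automorphism groups\<close>

lemma orbit_eq_of_mem:
  assumes "permutation f" "y \<in> orbit f x"
  shows "orbit f y = orbit f x"
  using orbit_cyclic_eq3[OF cyclic_on_orbit'[OF assms(1)] assms(2)] .

lemma cycle_on_perm_restrict_orbit:
  assumes "permutation f"
  shows "cycle_on (orbit f x) (perm_restrict f (orbit f x))"
proof -
  have cyc: "cyclic_on f (orbit f x)" using assms by (rule cyclic_on_orbit')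
  have inj: "inj_on f (orbit f x)"
    using permutation_bijective[OF assms] by (auto simp: bij_def intro: inj_on_subset)
  have "f ` orbit f x = orbit f x"
    using finite_cyclic_on[OF cyc] inj by (intro endo_inj_surj) (auto intro: orbit.step)
  with inj have "perm_restrict f (orbit f x) permutes orbit f x"
    by (intro bij_imp_permutes) (auto simp: perm_restrict_def bij_betw_def inj_on_def)
  then show ?thesis using cyc by (simp add: cycle_on_def cyclic_on_perm_restrict)
qed

lemma group_perm_group: "group (perm_group D)"
proof (rule groupI)
  fix p assume "p \<in> carrier (perm_group D)"
  then have p: "p permutes D" by (simp add: perm_group_def)
  show "\<exists>q\<in>carrier (perm_group D). q \<otimes>\<^bsub>perm_group D\<^esub> p = \<one>\<^bsub>perm_group D\<^esub>"
    using p permutes_inv[OF p] permutes_inv_o[OF p] by (auto simp: perm_group_def)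
qed (auto simp: perm_group_def permutes_compose permutes_id comp_assoc)

lemma group_aut_group: "group (aut_group M)"
proof (rule groupI)
  show "\<one>\<^bsub>aut_group M\<^esub> \<in> carrier (aut_group M)"
    by (simp add: aut_group_def perm_group_def hypermap_iso_def permutes_id)
next
  fix p q assume "p \<in> carrier (aut_group M)" "q \<in> carrier (aut_group M)"
  then show "p \<otimes>\<^bsub>aut_group M\<^esub> q \<in> carrier (aut_group M)"
    by (auto simp: aut_group_def perm_group_def permutes_compose intro: hypermap_iso_trans)
next
  fix p assume "p \<in> carrier (aut_group M)"
  then have p: "p permutes arcs M" and iso: "hypermap_iso M M p"
    by (simp_all add: aut_group_def)
  define q where "q = Hilbert_Choice.inv p"
  have q: "q permutes arcs M" and pq: "p (q \<alpha>) = \<alpha>" "q (p \<alpha>) = \<alpha>" "p \<circ> q = id" for \<alpha>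
    using permutes_inv[OF p] permutes_inverses[OF p] permutes_inv_o[OF p] by (simp_all add: q_def)
  have comm: "q (f \<alpha>) = f (q \<alpha>)"
    if f: "\<forall>\<alpha>\<in>arcs M. p (f \<alpha>) = f (p \<alpha>)" and "\<alpha> \<in> arcs M" for f \<alpha>
  proof -
    have "p (f (q \<alpha>)) = f \<alpha>"
      using f that(2) permutes_in_image[OF q] pq by auto
    then show ?thesis using pq by metis
  qed
  have "hypermap_iso M M q"
    using iso permutes_imp_bij[OF q] comm by (auto simp: hypermap_iso_def)
  then show "\<exists>q\<in>carrier (aut_group M). q \<otimes>\<^bsub>aut_group M\<^esub> p = \<one>\<^bsub>aut_group M\<^esub>"
    using q pq by (auto simp: aut_group_def perm_group_def)
qed (auto simp: aut_group_def perm_group_def comp_assoc)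

lemma oriented_hypermap_permutation:
  assumes "oriented_hypermap M"
  shows "permutation (vperm M)" "permutation (eperm M)"
  using assms by (auto simp: oriented_hypermap_def permutation_permutes)

lemma oriented_hypermap_orbit_subset:
  assumes "oriented_hypermap M" "\<alpha> \<in> arcs M"
  shows "orbit (vperm M) \<alpha> \<subseteq> arcs M" "orbit (eperm M) \<alpha> \<subseteq> arcs M"
  using assms by (auto simp: oriented_hypermap_def dest: permutes_orbit_subset)

lemma oriented_hypermap_perm_in_arcs:
  assumes "oriented_hypermap M" "\<alpha> \<in> arcs M"
  shows "vperm M \<alpha> \<in> arcs M" "eperm M \<alpha> \<in> arcs M"
  using assms by (auto simp: oriented_hypermap_def permutes_in_image)

lemma arc_eqI:
  assumes M: "oriented_hypermap M" and "\<alpha> \<in> arcs M" "\<beta> \<in> arcs M"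
    and v: "orbit (vperm M) \<alpha> = orbit (vperm M) \<beta>"
    and e: "orbit (eperm M) \<alpha> = orbit (eperm M) \<beta>"
  shows "\<alpha> = \<beta>"
proof -
  let ?S = "orbit (vperm M) \<alpha> \<inter> orbit (eperm M) \<alpha>"
  note P = oriented_hypermap_permutation[OF M]
  have "card ?S \<le> 1"
    using assms by (auto simp: oriented_hypermap_def hypervertices_def hyperedges_def)
  moreover have "finite ?S"
    using finite_cyclic_on[OF cyclic_on_orbit'[OF P(1)]] by blast
  moreover have "\<alpha> \<in> ?S" "\<beta> \<in> ?S"
    using v e permutation_self_in_orbit[OF P(1)] permutation_self_in_orbit[OF P(2)] by auto
  ultimately show ?thesis by (metis card_le_Suc0_iff_eq One_nat_def)
qed

text \<open>
  Finiteness makes a subset of the arcs that is mapped into itself by both permutations closed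
  under their inverses as well, hence under the whole transitive group they generate.
\<close>
lemma arcs_induct:
  assumes M: "oriented_hypermap M" and "\<alpha> \<in> arcs M" "\<beta> \<in> arcs M" and base: "P \<alpha>"
    and v: "\<And>\<alpha>. \<alpha> \<in> arcs M \<Longrightarrow> P \<alpha> \<Longrightarrow> P (vperm M \<alpha>)"
    and e: "\<And>\<alpha>. \<alpha> \<in> arcs M \<Longrightarrow> P \<alpha> \<Longrightarrow> P (eperm M \<alpha>)"
  shows "P \<beta>"
proof -
  let ?D = "arcs M"
  define S where "S = {\<alpha> \<in> ?D. P \<alpha>}"
  interpret group "perm_group ?D" by (rule group_perm_group)
  have fin: "finite S" using M by (simp add: S_def oriented_hypermap_def)
  have perm: "p permutes ?D" if "p \<in> {vperm M, eperm M}" for p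
    using that M by (auto simp: oriented_hypermap_def)
  have into: "p ` S \<subseteq> S" if "p \<in> {vperm M, eperm M}" for p
    using that v e oriented_hypermap_perm_in_arcs[OF M] by (auto simp: S_def)
  have "\<pi> ` S \<subseteq> S" if "\<pi> \<in> generate (perm_group ?D) {vperm M, eperm M}" for \<pi>
    using that
  proof induction
    case (inv p)
    have onto: "p ` S = S"
      using into[OF inv] fin permutes_inj[OF perm[OF inv]]
      by (intro endo_inj_surj) (auto intro: inj_on_subset)
    have "Hilbert_Choice.inv p \<otimes>\<^bsub>perm_group ?D\<^esub> p = \<one>\<^bsub>perm_group ?D\<^esub>"
      using permutes_inv_o[OF perm[OF inv]] by (simp add: perm_group_def)
    then have "inv\<^bsub>perm_group ?D\<^esub> p = Hilbert_Choice.inv p"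
      using perm[OF inv] permutes_inv[OF perm[OF inv]]
      by (intro inv_equality) (auto simp: perm_group_def)
    moreover have "Hilbert_Choice.inv p ` (p ` S) = S"
      using permutes_inj[OF perm[OF inv]] by (simp add: image_image)
    ultimately show ?case using onto by simp
  next
    case (eng p q)
    then show ?case by (auto simp: perm_group_def image_subset_iff)
  qed (use into in \<open>auto simp: perm_group_def\<close>)
  moreover obtain \<pi> where "\<pi> \<in> generate (perm_group ?D) {vperm M, eperm M}" "\<pi> \<alpha> = \<beta>"
    using M \<open>\<alpha> \<in> ?D\<close> \<open>\<beta> \<in> ?D\<close> unfolding oriented_hypermap_def by blast
  ultimately show ?thesis using assms(2) base by (auto simp: S_def)
qed

text \<open>
  Commuting with \<open>vperm M\<close> makes \<open>\<sigma>\<close> carry orbits onto orbits, so all the orbits in the union that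
  defines the action coincide.
\<close>
lemma hypervertex_act_orbit:
  assumes "permutation (vperm M)"
    and "\<And>\<beta>. \<beta> \<in> orbit (vperm M) \<alpha> \<Longrightarrow> \<sigma> (vperm M \<beta>) = vperm M (\<sigma> \<beta>)"
  shows "hypervertex_act M \<sigma> (orbit (vperm M) \<alpha>) = orbit (vperm M) (\<sigma> \<alpha>)"
proof -
  note self = permutation_self_in_orbit[OF assms(1)]
  have img: "\<sigma> ` orbit (vperm M) \<alpha> = orbit (vperm M) (\<sigma> \<alpha>)"
    using assms(2) by (intro orbit_inverse self) simp
  have "orbit (vperm M) (\<sigma> \<beta>) = orbit (vperm M) (\<sigma> \<alpha>)" if "\<beta> \<in> orbit (vperm M) \<alpha>" for \<beta>
    using that img by (intro orbit_eq_of_mem[OF assms(1)]) auto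
  then show ?thesis using self[of \<alpha>] unfolding hypervertex_act_def by blast
qed


section \<open>Regular labellings\<close>

text \<open>
  The label of an arc names its hypervertex by the group element that moves the base hypervertex,
  the one labelled \<open>\<one>\<close>, to it.  As permutations act on the right, the action is a right action:
  \<open>act (k \<otimes> l)\<close> is first \<open>act k\<close>, then \<open>act l\<close>.  Keeping \<open>G\<close> and its action abstract lets \<open>G\<close> be
  both the group of a Cayley hypermap and a group of automorphisms.
\<close>
locale regular_labelling = G: group G
  for M :: "'a hypermap" and G :: "('g, 'b) monoid_scheme" (structure)
    and act :: "'g \<Rightarrow> 'a \<Rightarrow> 'a" and \<gamma> :: "'a \<Rightarrow> 'g" +
  assumes act_closed: "k \<in> carrier G \<Longrightarrow> \<alpha> \<in> arcs M \<Longrightarrow> act k \<alpha> \<in> arcs M"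
    and act_one: "\<alpha> \<in> arcs M \<Longrightarrow> act \<one> \<alpha> = \<alpha>"
    and act_mult: "k \<in> carrier G \<Longrightarrow> l \<in> carrier G \<Longrightarrow> \<alpha> \<in> arcs M \<Longrightarrow>
          act (k \<otimes> l) \<alpha> = act l (act k \<alpha>)"
    and act_vperm: "k \<in> carrier G \<Longrightarrow> \<alpha> \<in> arcs M \<Longrightarrow> act k (vperm M \<alpha>) = vperm M (act k \<alpha>)"
    and act_eperm: "k \<in> carrier G \<Longrightarrow> \<alpha> \<in> arcs M \<Longrightarrow> act k (eperm M \<alpha>) = eperm M (act k \<alpha>)"
    and label_closed: "\<alpha> \<in> arcs M \<Longrightarrow> \<gamma> \<alpha> \<in> carrier G"
    and label_act: "k \<in> carrier G \<Longrightarrow> \<alpha> \<in> arcs M \<Longrightarrow> \<gamma> (act k \<alpha>) = \<gamma> \<alpha> \<otimes> k"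
    and label_eq_iff: "\<alpha> \<in> arcs M \<Longrightarrow> \<beta> \<in> arcs M \<Longrightarrow>
          \<gamma> \<alpha> = \<gamma> \<beta> \<longleftrightarrow> orbit (vperm M) \<alpha> = orbit (vperm M) \<beta>"

text \<open>
  The hypervertices of a Cayley hypermap are the fibres of the first coordinate because \<open>\<rho>\<close> is a
  single cycle on all of \<open>[Y]\<close>; and right multiplication commutes with both permutations because
  these are defined by operations on the left factors of \<open>x g\<close>, \<open>a h\<close> and \<open>y h\<close>.
\<close>
lemma regular_labelling_CM:
  fixes G :: "('g, 'b) monoid_scheme" (structure)
  assumes data: "cayley_hypermap_data G Y \<rho> \<tau>"
  shows "regular_labelling (CM G Y \<rho> \<tau>) G (\<lambda>k (g, e). (g \<otimes> k, e #> k)) fst"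
proof -
  interpret group G using data by (simp add: cayley_hypermap_data_def)
  let ?C = "hyperset_closure G Y" and ?M = "CM G Y \<rho> \<tau>"
  note Csub = hyperset_closure_subset[OF data] and Ysub = hyperset_subset[OF data]
  have arcs: "arcs ?M = CM_arcs G Y" by (simp add: CM_def)
  have arcE: thesis
    if "\<alpha> \<in> arcs ?M" "\<And>g x. g \<in> carrier G \<Longrightarrow> x \<in> ?C \<Longrightarrow> \<alpha> = (g, x #> g) \<Longrightarrow> thesis"
    for \<alpha> thesis
    using that by (auto simp: arcs CM_arcs_def)
  have arcI: "(g, x #> g) \<in> arcs ?M" if "g \<in> carrier G" "x \<in> ?C" for g x
    using that by (auto simp: arcs CM_arcs_def)
  have \<rho>: "cycle_on ?C \<rho>" using data by (simp add: cayley_hypermap_data_def)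
  then have \<rho>_in: "\<rho> x \<in> ?C" if "x \<in> ?C" for x
    using that by (simp add: cycle_on_def permutes_in_image)
  have \<tau>_in: "\<tau> y a \<in> y" if "y \<in> Y" "a \<in> y" for y a
    using that data
    by (auto simp: cayley_hypermap_data_def ideal_cycle_def cycle_on_def permutes_in_image)
  have orb: "orbit (vperm ?M) (g, x #> g) = (\<lambda>x. (g, x #> g)) ` ?C"
    if "g \<in> carrier G" "x \<in> ?C" for g x
  proof -
    have "cyclic_on (vperm ?M) ((\<lambda>x. (g, x #> g)) ` ?C)"
      using \<rho> that by (intro cyclic_on_image[of \<rho>]) (auto simp: cycle_on_def CM_vperm[OF data])
    then show ?thesis using that by (intro orbit_cyclic_eq3) auto
  qed
  show ?thesis
  proof (unfold_locales, goal_cases)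
    case (1 k \<alpha>)
    then show ?case by (elim arcE) (simp add: coset_mult_assoc Csub arcI)
  next
    case (2 \<alpha>)
    then show ?case by (elim arcE) (simp add: Csub coset_mult_assoc)
  next
    case (3 k l \<alpha>)
    then show ?case by (elim arcE) (simp add: Csub coset_mult_assoc m_assoc)
  next
    case (4 k \<alpha>)
    then show ?case
      by (elim arcE) (simp add: Csub coset_mult_assoc CM_vperm[OF data] \<rho>_in)
  next
    case (5 k \<alpha>)
    then obtain y a h where *: "y \<in> Y" "a \<in> y" "h \<in> carrier G" "\<alpha> = (a \<otimes> h, y #> h)"
      unfolding arcs CM_arcs_altdef[OF data] by blast
    have "a \<in> carrier G" "\<tau> y a \<in> carrier G" using * Ysub \<tau>_in by blast+
    then show ?case
      using * 5 by (simp add: CM_eperm[OF data] coset_mult_assoc m_assoc Ysub)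
  next
    case (6 \<alpha>)
    then show ?case by (elim arcE) simp
  next
    case (7 k \<alpha>)
    then show ?case by (elim arcE) simp
  next
    case (8 \<alpha> \<beta>)
    then show ?case by (elim arcE) (auto simp: orb)
  qed
qed

lemma regular_labelling_transfer:
  assumes M: "oriented_hypermap M" and iso: "hypermap_iso M M' \<psi>"
    and lab: "regular_labelling M' G act \<gamma>"
  shows "regular_labelling M G (\<lambda>k \<alpha>. inv_into (arcs M) \<psi> (act k (\<psi> \<alpha>))) (\<gamma> \<circ> \<psi>)"
proof -
  interpret L: regular_labelling M' G act \<gamma> by (rule lab)
  let ?i = "inv_into (arcs M) \<psi>"
  have inj: "inj_on \<psi> (arcs M)" and img: "\<psi> ` arcs M = arcs M'"
    and v: "\<And>\<alpha>. \<alpha> \<in> arcs M \<Longrightarrow> \<psi> (vperm M \<alpha>) = vperm M' (\<psi> \<alpha>)"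
    and e: "\<And>\<alpha>. \<alpha> \<in> arcs M \<Longrightarrow> \<psi> (eperm M \<alpha>) = eperm M' (\<psi> \<alpha>)"
    using iso by (auto simp: hypermap_iso_def bij_betw_def)
  have \<psi>_in: "\<psi> \<alpha> \<in> arcs M'" if "\<alpha> \<in> arcs M" for \<alpha> using that img by blast
  have i_in: "?i \<beta> \<in> arcs M" and \<psi>i: "\<psi> (?i \<beta>) = \<beta>" if "\<beta> \<in> arcs M'" for \<beta>
    using that by (simp_all add: inv_into_into f_inv_into_f flip: img)
  have i_eq: "?i \<beta> = \<alpha>" if "\<alpha> \<in> arcs M" "\<beta> = \<psi> \<alpha>" for \<alpha> \<beta>
    using that inj by simp
  note perm_in = oriented_hypermap_perm_in_arcs[OF M]
  note sub = oriented_hypermap_orbit_subset(1)[OF M]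
  have orb: "\<psi> ` orbit (vperm M) \<alpha> = orbit (vperm M') (\<psi> \<alpha>)" if "\<alpha> \<in> arcs M" for \<alpha>
    using sub[OF that] v permutation_self_in_orbit oriented_hypermap_permutation[OF M]
    by (intro orbit_inverse) auto
  show ?thesis
  proof (unfold_locales, goal_cases)
    case (8 \<alpha> \<beta>)
    then have "\<psi> ` orbit (vperm M) \<alpha> = \<psi> ` orbit (vperm M) \<beta> \<longleftrightarrow>
        orbit (vperm M) \<alpha> = orbit (vperm M) \<beta>"
      by (intro inj_on_image_eq_iff[OF inj] sub)
    then show ?case using 8 by (simp add: L.label_eq_iff \<psi>_in orb)
  qed (auto simp: \<psi>_in i_in \<psi>i perm_in v e L.act_closed L.act_one L.act_mult L.act_vperm L.act_eperm
       L.label_closed L.label_act intro!: i_eq)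
qed

context regular_labelling
begin

lemma act_inv:
  assumes "k \<in> carrier G" "\<alpha> \<in> arcs M"
  shows "act (inv k) (act k \<alpha>) = \<alpha>" "act k (act (inv k) \<alpha>) = \<alpha>"
  using assms by (simp_all add: act_one flip: act_mult)

lemma bij_betw_act: "k \<in> carrier G \<Longrightarrow> bij_betw (act k) (arcs M) (arcs M)"
  by (rule bij_betw_byWitness[where f' = "act (inv k)"]) (auto simp: act_inv act_closed)

text \<open>
  Each group element yields an automorphism, extended by the identity outside the arcs.  On
  hypervertices this is the right regular action of \<open>G\<close> on itself, since hypervertices correspond
  to labels and all labels occur.
\<close>
lemma regular_subgroup_exists:
  assumes M: "oriented_hypermap M"
  shows "\<exists>H. subgroup H (aut_group M) \<and> regular_on_hypervertices M H"
proof -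
  interpret A: group "aut_group M" by (rule group_aut_group)
  define R where "R k = restrict_id (act k) (arcs M)" for k
  have R: "R k \<alpha> = act k \<alpha>" if "\<alpha> \<in> arcs M" for k \<alpha> using that by (simp add: R_def)
  have R_out: "R k \<alpha> = \<alpha>" if "\<alpha> \<notin> arcs M" for k \<alpha> using that by (simp add: R_def)
  note perm_in = oriented_hypermap_perm_in_arcs[OF M]
  have R_aut: "R k \<in> carrier (aut_group M)" if "k \<in> carrier G" for k
  proof -
    have "bij_betw (R k) (arcs M) (arcs M)"
      using bij_betw_act[OF that] R by (simp cong: bij_betw_cong)
    then show ?thesis
      using that R_out perm_in
      by (auto simp: aut_group_def hypermap_iso_def R act_vperm act_eperm intro: bij_imp_permutes)
  qed
  have R_mult: "R k \<otimes>\<^bsub>aut_group M\<^esub> R l = R (k \<otimes> l)" if "k \<in> carrier G" "l \<in> carrier G" for k l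
  proof
    fix \<alpha> show "(R k \<otimes>\<^bsub>aut_group M\<^esub> R l) \<alpha> = R (k \<otimes> l) \<alpha>"
      using that by (cases "\<alpha> \<in> arcs M")
        (simp_all add: aut_group_def perm_group_def R R_out act_closed act_mult)
  qed
  interpret R: group_hom G "aut_group M" R
    by unfold_locales (auto simp: hom_def R_aut R_mult)
  let ?H = "R ` carrier G"
  have "subgroup ?H (aut_group M)" by (rule R.img_is_subgroup)
  moreover have orb: "hypervertex_act M (R k) (orbit (vperm M) \<alpha>) = orbit (vperm M) (act k \<alpha>)"
    if "k \<in> carrier G" "\<alpha> \<in> arcs M" for k \<alpha>
    using that oriented_hypermap_permutation(1)[OF M] oriented_hypermap_orbit_subset(1)[OF M] perm_in
    by (subst hypervertex_act_orbit) (auto simp: R act_vperm subset_iff)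
  have "regular_on_hypervertices M ?H"
    unfolding regular_on_hypervertices_def hypervertices_def
  proof (intro conjI ballI impI; elim imageE; hypsubst)
    fix \<alpha> \<beta> assume \<alpha>\<beta>: "\<alpha> \<in> arcs M" "\<beta> \<in> arcs M"
    \<comment> \<open>Labels are multiplied on the right, so this element takes the label of \<open>\<alpha>\<close> to that of \<open>\<beta>\<close>.\<close>
    let ?k = "inv \<gamma> \<alpha> \<otimes> \<gamma> \<beta>"
    have k: "?k \<in> carrier G" using \<alpha>\<beta> by (simp add: label_closed)
    have "\<gamma> (act ?k \<alpha>) = \<gamma> \<beta>"
      using \<alpha>\<beta> k by (simp add: label_act label_closed flip: G.m_assoc)
    then have "hypervertex_act M (R ?k) (orbit (vperm M) \<alpha>) = orbit (vperm M) \<beta>"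
      using \<alpha>\<beta> k by (simp add: orb label_eq_iff act_closed)
    with k show "\<exists>\<sigma>\<in>?H. hypervertex_act M \<sigma> (orbit (vperm M) \<alpha>) = orbit (vperm M) \<beta>" by blast
  next
    fix \<alpha> k assume \<alpha>: "\<alpha> \<in> arcs M" and k: "k \<in> carrier G"
      and "hypervertex_act M (R k) (orbit (vperm M) \<alpha>) = orbit (vperm M) \<alpha>"
    then have "\<gamma> \<alpha> \<otimes> k = \<gamma> \<alpha>" by (simp add: orb label_eq_iff act_closed flip: label_act)
    then have "k = \<one>" using \<alpha> k label_closed by simp
    then show "R k = id" using R.hom_one by (simp add: aut_group_def perm_group_def)
  qed
  ultimately show ?thesis by blast
qed

end

text \<open>
  Transitivity supplies, for each arc, an element of \<open>H\<close> that moves a fixed base hypervertex to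
  the hypervertex of the arc; triviality of stabilisers makes it unique, and uniqueness gives both
  the equivariance of the labelling and the description of its fibres.
\<close>
lemma regular_labelling_of_regular_subgroup:
  assumes M: "oriented_hypermap M" and H: "subgroup H (aut_group M)"
    and reg: "regular_on_hypervertices M H"
  shows "\<exists>\<gamma>. regular_labelling M ((aut_group M)\<lparr>carrier := H\<rparr>) (\<lambda>\<sigma>. \<sigma>) \<gamma>"
proof -
  interpret A: group "aut_group M" by (rule group_aut_group)
  let ?G = "(aut_group M)\<lparr>carrier := H\<rparr>" and ?V = "orbit (vperm M)"
  interpret G: group ?G using H by (rule A.subgroup_imp_group)
  have mult: "\<sigma> \<otimes>\<^bsub>?G\<^esub> \<sigma>' = \<sigma>' \<circ> \<sigma>" for \<sigma> \<sigma>' by (simp add: aut_group_def perm_group_def)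
  have one: "\<one>\<^bsub>?G\<^esub> = id" by (simp add: aut_group_def perm_group_def)
  have comp: "\<sigma>' \<circ> \<sigma> \<in> H" if "\<sigma> \<in> H" "\<sigma>' \<in> H" for \<sigma> \<sigma>'
    using G.m_closed[of \<sigma> \<sigma>'] that by (simp add: mult[simplified])
  have "H \<subseteq> carrier (aut_group M)" using H by (rule subgroup.subset)
  then have aut: "\<sigma> permutes arcs M" "hypermap_iso M M \<sigma>" if "\<sigma> \<in> H" for \<sigma>
    using that by (auto simp: aut_group_def)
  then have act_in: "\<sigma> \<alpha> \<in> arcs M" if "\<sigma> \<in> H" "\<alpha> \<in> arcs M" for \<sigma> \<alpha>
    using that by (simp add: permutes_in_image)
  have comm: "\<sigma> (vperm M \<alpha>) = vperm M (\<sigma> \<alpha>)" "\<sigma> (eperm M \<alpha>) = eperm M (\<sigma> \<alpha>)"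
    if "\<sigma> \<in> H" "\<alpha> \<in> arcs M" for \<sigma> \<alpha>
    using aut[OF that(1)] that(2) by (auto simp: hypermap_iso_def)
  have orb: "hypervertex_act M \<sigma> (?V \<alpha>) = ?V (\<sigma> \<alpha>)" if "\<sigma> \<in> H" "\<alpha> \<in> arcs M" for \<sigma> \<alpha>
    using that oriented_hypermap_permutation(1)[OF M] oriented_hypermap_orbit_subset(1)[OF M]
    by (intro hypervertex_act_orbit comm) auto
  obtain \<alpha>\<^sub>0 where \<alpha>\<^sub>0: "\<alpha>\<^sub>0 \<in> arcs M" using M by (auto simp: oriented_hypermap_def)
  have ex: "\<exists>\<sigma>\<in>H. ?V (\<sigma> \<alpha>\<^sub>0) = ?V \<alpha>" if "\<alpha> \<in> arcs M" for \<alpha>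
    using reg that \<alpha>\<^sub>0 orb
    by (auto simp: regular_on_hypervertices_def hypervertices_def)
  have V_act: "?V (\<sigma> \<alpha>) = ?V (\<sigma> \<beta>)" if "?V \<alpha> = ?V \<beta>" "\<sigma> \<in> H" "\<alpha> \<in> arcs M" "\<beta> \<in> arcs M" for \<sigma> \<alpha> \<beta>
    using that(1) orb[OF that(2,3)] orb[OF that(2,4)] by simp
  have unique: "\<sigma> = \<sigma>'" if "\<sigma> \<in> H" "\<sigma>' \<in> H" "?V (\<sigma> \<alpha>\<^sub>0) = ?V (\<sigma>' \<alpha>\<^sub>0)" for \<sigma> \<sigma>'
  proof -
    let ?\<iota> = "inv\<^bsub>?G\<^esub> \<sigma>'"
    have i: "?\<iota> \<in> H" using G.inv_closed[of \<sigma>'] that by simp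
    have inv: "?\<iota> \<circ> \<sigma>' = id" "\<sigma>' \<circ> ?\<iota> = id"
      using G.r_inv[of \<sigma>'] G.l_inv[of \<sigma>'] that by (simp_all add: mult[simplified] one[simplified])
    \<comment> \<open>First \<open>\<sigma>\<close>, then the inverse of \<open>\<sigma>'\<close>, stabilises the base hypervertex.\<close>
    have "?V (?\<iota> (\<sigma> \<alpha>\<^sub>0)) = ?V (?\<iota> (\<sigma>' \<alpha>\<^sub>0))"
      using V_act[OF that(3) i act_in[OF that(1) \<alpha>\<^sub>0] act_in[OF that(2) \<alpha>\<^sub>0]] .
    also have "?\<iota> (\<sigma>' \<alpha>\<^sub>0) = \<alpha>\<^sub>0" using fun_cong[OF inv(1), of \<alpha>\<^sub>0] by simp
    finally have "hypervertex_act M (?\<iota> \<circ> \<sigma>) (?V \<alpha>\<^sub>0) = ?V \<alpha>\<^sub>0"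
      using comp[OF that(1) i] \<alpha>\<^sub>0 by (simp add: orb)
    then have "?\<iota> \<circ> \<sigma> = id"
      using reg comp[OF that(1) i] \<alpha>\<^sub>0 by (auto simp: regular_on_hypervertices_def hypervertices_def)
    then have "(\<sigma>' \<circ> ?\<iota>) \<circ> \<sigma> = \<sigma>'" by (simp only: comp_assoc comp_id)
    then show ?thesis by (simp only: inv(2) id_comp)
  qed
  define \<gamma> where "\<gamma> \<alpha> = (SOME \<sigma>. \<sigma> \<in> H \<and> ?V (\<sigma> \<alpha>\<^sub>0) = ?V \<alpha>)" for \<alpha>
  have \<gamma>: "\<gamma> \<alpha> \<in> H" "?V (\<gamma> \<alpha> \<alpha>\<^sub>0) = ?V \<alpha>" if "\<alpha> \<in> arcs M" for \<alpha>
    using someI_ex[of "\<lambda>\<sigma>. \<sigma> \<in> H \<and> ?V (\<sigma> \<alpha>\<^sub>0) = ?V \<alpha>"] ex[OF that] unfolding \<gamma>_def by blast+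
  have \<gamma>_eqI: "\<gamma> \<alpha> = \<sigma>" if "\<sigma> \<in> H" "?V (\<sigma> \<alpha>\<^sub>0) = ?V \<alpha>" "\<alpha> \<in> arcs M" for \<alpha> \<sigma>
    using that \<gamma> by (intro unique) auto
  have "regular_labelling M ?G (\<lambda>\<sigma>. \<sigma>) \<gamma>"
  proof (unfold_locales, goal_cases)
    case (1 \<sigma> \<alpha>) then show ?case by (simp add: act_in)
  next
    case (2 \<alpha>) show ?case by (simp only: one id_apply)
  next
    case (3 \<sigma> \<sigma>' \<alpha>) show ?case by (simp only: mult comp_apply)
  next
    case (4 \<sigma> \<alpha>) then show ?case by (simp add: comm)
  next
    case (5 \<sigma> \<alpha>) then show ?case by (simp add: comm)
  next
    case (6 \<alpha>) then show ?case by (simp add: \<gamma>)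
  next
    case (7 \<sigma> \<alpha>)
    then have \<sigma>: "\<sigma> \<in> H" and \<alpha>: "\<alpha> \<in> arcs M" by simp_all
    note V_act[OF \<gamma>(2)[OF \<alpha>] \<sigma> act_in[OF \<gamma>(1)[OF \<alpha>] \<alpha>\<^sub>0] \<alpha>]
    with \<sigma> \<alpha> show ?case unfolding mult using \<gamma>(1)[OF \<alpha>] comp act_in[OF \<sigma> \<alpha>] by (intro \<gamma>_eqI) auto
  next
    case (8 \<alpha> \<beta>)
    show ?case
    proof
      assume "\<gamma> \<alpha> = \<gamma> \<beta>" then show "?V \<alpha> = ?V \<beta>" using \<gamma>(2)[OF 8(1)] \<gamma>(2)[OF 8(2)] by simp
    next
      assume "?V \<alpha> = ?V \<beta>" then show "\<gamma> \<alpha> = \<gamma> \<beta>" using \<gamma> 8 by (intro \<gamma>_eqI) auto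
    qed
  qed
  then show ?thesis by blast
qed


section \<open>Cayley hypermaps from regular labellings\<close>

text \<open>
  On sets containing \<open>\<one>\<close>, Cayley equivalence is an equivalence relation: \<open>\<one>\<close> itself gives
  reflexivity, \<open>(x g\<^sup>-\<^sup>1) (k g\<^sup>-\<^sup>1)\<^sup>-\<^sup>1 = x k\<^sup>-\<^sup>1\<close> gives transitivity, and \<open>g\<^sup>-\<^sup>1 \<in> x g\<^sup>-\<^sup>1\<close> gives symmetry.  A
  closed family is a union of equivalence classes, and one representative from each class
  recovers it.
\<close>
lemma (in group) hyperset_representatives:
  assumes one: "\<And>x. x \<in> C \<Longrightarrow> x \<subseteq> carrier G \<and> \<one> \<in> x"
    and closed: "\<And>x g. x \<in> C \<Longrightarrow> g \<in> x \<Longrightarrow> x #> inv g \<in> C"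
  obtains Y where "Y \<subseteq> C" "non_cayley_equivalent_hyperset G Y" "hyperset_closure G Y = C"
proof -
  define cls where "cls x = {x #> inv g | g. g \<in> x}" for x
  have cls_subset: "cls y \<subseteq> cls x" if "x \<in> C" and y: "y \<in> cls x" for x y
  proof
    fix z assume "z \<in> cls y"
    then obtain g h where gh: "g \<in> x" "y = x #> inv g" "h \<in> y" "z = y #> inv h"
      using y unfolding cls_def by blast
    note x = one[OF that(1)]
    then have g: "g \<in> carrier G" using gh by auto
    obtain k where k: "k \<in> x" "h = k \<otimes> inv g" using gh by (auto simp: r_coset_def)
    then have "k \<in> carrier G" using x by auto
    then have "z = x #> inv k"
      using gh x g k by (simp add: coset_mult_assoc inv_mult_group flip: m_assoc)
    then show "z \<in> cls x" using k by (auto simp: cls_def)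
  qed
  have self: "x \<in> cls x" if "x \<in> C" for x
    using one[OF that] coset_mult_one[of x] by (auto simp: cls_def intro!: exI[of _ \<one>])
  have cls_sym: "x \<in> cls y" if "x \<in> C" and y: "y \<in> cls x" for x y
  proof -
    obtain g where g: "g \<in> x" "y = x #> inv g" using y unfolding cls_def by blast
    note x = one[OF that(1)]
    have gc: "g \<in> carrier G" using g x by auto
    have "\<one> \<otimes> inv g \<in> y" using g x by (auto simp: r_coset_def)
    moreover have "y #> inv (inv g) = x" using g x gc by (simp add: coset_mult_assoc)
    ultimately show ?thesis using gc unfolding cls_def by force
  qed
  have cls_C: "cls x \<subseteq> C" if "x \<in> C" for x using closed that by (auto simp: cls_def)
  have cls_eq: "cls y = cls x" if "x \<in> C" "y \<in> cls x" for x y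
    using that cls_subset cls_sym cls_C by blast
  define rep where "rep x = (SOME y. y \<in> cls x)" for x
  have rep: "rep x \<in> cls x" if "x \<in> C" for x
    unfolding rep_def using self[OF that] by (rule someI)
  have rep_eq: "rep y = rep x" if "x \<in> C" "y \<in> cls x" for x y
    by (simp add: rep_def cls_eq[OF that])
  let ?Y = "rep ` C"
  have Y: "?Y \<subseteq> C" using rep cls_C by blast
  moreover have "non_cayley_equivalent_hyperset G ?Y"
    unfolding non_cayley_equivalent_hyperset_def
  proof (intro conjI ballI impI)
    fix y y' assume y: "y \<in> ?Y" "y' \<in> ?Y" "y \<noteq> y'"
    show "\<not> cayley_equivalent G y y'"
    proof
      assume "cayley_equivalent G y y'"
      then have "y' \<in> cls y" by (auto simp: cayley_equivalent_def cls_def)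
      then have "rep y' = rep y" using y Y by (intro rep_eq) auto
      moreover have "rep z = z" if "z \<in> ?Y" for z
        using that rep_eq rep by auto
      ultimately show False using y by metis
    qed
  qed (use Y one in blast)+
  moreover have "hyperset_closure G ?Y = C"
  proof
    show "hyperset_closure G ?Y \<subseteq> C" using Y closed by (auto simp: hyperset_closure_def)
    show "C \<subseteq> hyperset_closure G ?Y"
    proof
      fix x assume x: "x \<in> C"
      then have "x \<in> cls (rep x)" using rep cls_sym by blast
      then show "x \<in> hyperset_closure G ?Y" using x by (auto simp: hyperset_closure_def cls_def)
    qed
  qed
  ultimately show thesis using that by blast
qed

context regular_labelling
begin

text \<open>
  As labels name hypervertices, this is the set of hypervertices incident with the hyperedge of
  \<open>\<alpha>\<close>, read as a subset of \<open>G\<close>.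
\<close>
definition edge_labels :: "'a \<Rightarrow> 'g set" where
  "edge_labels \<alpha> = \<gamma> ` orbit (eperm M) \<alpha>"

definition edge_cycle :: "'a \<Rightarrow> 'g \<Rightarrow> 'g" where
  "edge_cycle \<alpha> = map_permutation (orbit (eperm M) \<alpha>) \<gamma>
     (perm_restrict (eperm M) (orbit (eperm M) \<alpha>))"

context
  assumes M: "oriented_hypermap M"
begin

lemma label_vperm:
  assumes "\<alpha> \<in> arcs M"
  shows "\<gamma> (vperm M \<alpha>) = \<gamma> \<alpha>"
  using assms label_eq_iff[of "vperm M \<alpha>" \<alpha>] oriented_hypermap_perm_in_arcs(1)[OF M]
    permutation_orbit_step[OF oriented_hypermap_permutation(1)[OF M]] by simp

lemma eperm_orbit_act:
  assumes "k \<in> carrier G" "\<alpha> \<in> arcs M"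
  shows "orbit (eperm M) (act k \<alpha>) = act k ` orbit (eperm M) \<alpha>"
  using assms oriented_hypermap_orbit_subset(2)[OF M]
  by (intro orbit_inverse[symmetric] permutation_self_in_orbit oriented_hypermap_permutation M)
    (auto simp: act_eperm subset_iff)

lemma arc_eq_if_label_eq:
  assumes "\<alpha> \<in> arcs M" "\<beta> \<in> arcs M" "\<gamma> \<alpha> = \<gamma> \<beta>" "orbit (eperm M) \<alpha> = orbit (eperm M) \<beta>"
  shows "\<alpha> = \<beta>"
  using assms by (intro arc_eqI[OF M]) (auto simp: label_eq_iff)

lemma inj_on_label_eperm_orbit:
  assumes "\<alpha> \<in> arcs M"
  shows "inj_on \<gamma> (orbit (eperm M) \<alpha>)"
proof (intro inj_onI arc_eq_if_label_eq)
  fix \<beta> \<beta>' assume \<beta>: "\<beta> \<in> orbit (eperm M) \<alpha>" "\<beta>' \<in> orbit (eperm M) \<alpha>"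
  note eq = orbit_eq_of_mem[OF oriented_hypermap_permutation(2)[OF M]]
  show "orbit (eperm M) \<beta> = orbit (eperm M) \<beta>'" using eq[OF \<beta>(1)] eq[OF \<beta>(2)] by simp
qed (use oriented_hypermap_orbit_subset(2)[OF M assms] in auto)

lemma edge_labels_subset: "\<alpha> \<in> arcs M \<Longrightarrow> edge_labels \<alpha> \<subseteq> carrier G"
  using oriented_hypermap_orbit_subset(2)[OF M] label_closed by (auto simp: edge_labels_def)

lemma label_in_edge_labels: "\<gamma> \<alpha> \<in> edge_labels \<alpha>"
  using permutation_self_in_orbit[OF oriented_hypermap_permutation(2)[OF M]]
  by (auto simp: edge_labels_def)

lemma edge_labels_mem:
  assumes "\<beta> \<in> orbit (eperm M) \<alpha>"
  shows "edge_labels \<beta> = edge_labels \<alpha>"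
  using orbit_eq_of_mem[OF oriented_hypermap_permutation(2)[OF M] assms]
  by (simp add: edge_labels_def)

lemma edge_labels_act:
  assumes "k \<in> carrier G" "\<alpha> \<in> arcs M"
  shows "edge_labels (act k \<alpha>) = edge_labels \<alpha> #> k"
proof -
  have "edge_labels (act k \<alpha>) = (\<lambda>\<beta>. \<gamma> (act k \<beta>)) ` orbit (eperm M) \<alpha>"
    using assms by (simp add: edge_labels_def eperm_orbit_act image_image)
  also have "\<dots> = (\<lambda>\<beta>. \<gamma> \<beta> \<otimes> k) ` orbit (eperm M) \<alpha>"
    using assms oriented_hypermap_orbit_subset(2)[OF M]
    by (intro image_cong) (auto simp: label_act subset_iff)
  finally show ?thesis by (auto simp: r_coset_def edge_labels_def)
qed

text \<open>
  Equal label sets mean equal sets of incident hypervertices, which simplicity forbids for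
  distinct hyperedges.
\<close>
lemma eperm_orbit_eq_if_edge_labels_eq:
  assumes simple: "simple_underlying M"
    and \<alpha>\<beta>: "\<alpha> \<in> arcs M" "\<beta> \<in> arcs M" "edge_labels \<alpha> = edge_labels \<beta>"
  shows "orbit (eperm M) \<alpha> = orbit (eperm M) \<beta>"
proof -
  note perm = oriented_hypermap_permutation(1)[OF M] and sub = oriented_hypermap_orbit_subset[OF M]
  have "incident_hypervertices M (orbit (eperm M) \<alpha>)
      \<subseteq> incident_hypervertices M (orbit (eperm M) \<beta>)"
  proof
    fix v assume "v \<in> incident_hypervertices M (orbit (eperm M) \<alpha>)"
    then obtain \<delta> \<epsilon> where \<delta>: "\<delta> \<in> arcs M" "v = orbit (vperm M) \<delta>" "\<epsilon> \<in> orbit (vperm M) \<delta>"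
        "\<epsilon> \<in> orbit (eperm M) \<alpha>"
      by (auto simp: incident_hypervertices_def hypervertices_def)
    then obtain \<zeta> where \<zeta>: "\<zeta> \<in> orbit (eperm M) \<beta>" "\<gamma> \<epsilon> = \<gamma> \<zeta>"
      using \<alpha>\<beta>(3) by (auto simp: edge_labels_def)
    have "\<epsilon> \<in> arcs M" "\<zeta> \<in> arcs M" using \<delta> \<zeta> sub(1)[OF \<delta>(1)] sub(2)[OF \<alpha>\<beta>(2)] by blast+
    then have "orbit (vperm M) \<epsilon> = orbit (vperm M) \<zeta>" using \<zeta> label_eq_iff by blast
    then have "\<zeta> \<in> v"
      using \<delta> orbit_eq_of_mem[OF perm \<delta>(3)] permutation_self_in_orbit[OF perm, of \<zeta>] by simp
    then show "v \<in> incident_hypervertices M (orbit (eperm M) \<beta>)"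
      using \<delta> \<zeta> by (auto simp: incident_hypervertices_def hypervertices_def)
  qed
  then show ?thesis using simple \<alpha>\<beta> by (auto simp: simple_underlying_def hyperedges_def)
qed

lemma cycle_on_edge_cycle:
  assumes "\<alpha> \<in> arcs M"
  shows "cycle_on (edge_labels \<alpha>) (edge_cycle \<alpha>)"
  unfolding edge_labels_def edge_cycle_def
  by (intro cycle_on_map_permutation cycle_on_perm_restrict_orbit inj_on_label_eperm_orbit assms
      oriented_hypermap_permutation M)

lemma edge_cycle_label:
  assumes "\<alpha> \<in> arcs M" "\<beta> \<in> orbit (eperm M) \<alpha>"
  shows "edge_cycle \<alpha> (\<gamma> \<beta>) = \<gamma> (eperm M \<beta>)"
  using assms inj_on_label_eperm_orbit[OF assms(1)]
  by (simp add: edge_cycle_def map_permutation_apply perm_restrict_def)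

text \<open>
  If \<open>y g = y\<close> for the label set \<open>y\<close> of a hyperedge, then the hyperedge and its image under \<open>g\<close>
  have the same label set, so they agree by simplicity.  Hence \<open>g\<close> permutes the arcs of the
  hyperedge and commutes with its rotation, which is the ideal property read in terms of labels.
\<close>
lemma ideal_edge_cycle:
  assumes simple: "simple_underlying M" and \<alpha>: "\<alpha> \<in> arcs M"
  shows "ideal_cycle G (edge_labels \<alpha>) (edge_cycle \<alpha>)"
  unfolding ideal_cycle_def
proof (intro conjI ballI impI cycle_on_edge_cycle \<alpha>)
  let ?y = "edge_labels \<alpha>"
  fix g assume g: "g \<in> carrier G" "?y #> g = ?y"
  let ?r = "\<lambda>a. a \<otimes> g" and ?q = "map_permutation ?y (\<lambda>a. a \<otimes> g) (edge_cycle \<alpha>)"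
  note ysub = edge_labels_subset[OF \<alpha>]
  have inj: "inj_on ?r ?y" using g ysub by (intro inj_onI) (auto simp: subset_iff)
  have img: "?r ` ?y = ?y" using g(2) by (auto simp: r_coset_def)
  have "orbit (eperm M) (act g \<alpha>) = orbit (eperm M) \<alpha>"
    using g \<alpha> by (intro eperm_orbit_eq_if_edge_labels_eq simple) (simp_all add: act_closed edge_labels_act)
  then have stable: "act g \<beta> \<in> orbit (eperm M) \<alpha>" if "\<beta> \<in> orbit (eperm M) \<alpha>" for \<beta>
    using that g \<alpha> by (auto simp: eperm_orbit_act)
  show "?q = edge_cycle \<alpha>"
  proof
    fix c
    show "?q c = edge_cycle \<alpha> c"
    proof (cases "c \<in> ?y")
      case True
      then obtain a where a: "a \<in> ?y" "c = a \<otimes> g" using img by blast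
      then obtain \<beta> where \<beta>: "\<beta> \<in> orbit (eperm M) \<alpha>" "a = \<gamma> \<beta>" by (auto simp: edge_labels_def)
      then have \<beta>D: "\<beta> \<in> arcs M" using oriented_hypermap_orbit_subset(2)[OF M \<alpha>] by blast
      have "?q c = edge_cycle \<alpha> a \<otimes> g" using map_permutation_apply[OF inj a(1)] a(2) by simp
      also have "\<dots> = \<gamma> (act g (eperm M \<beta>))"
        using \<alpha> \<beta> \<beta>D g by (simp add: edge_cycle_label label_act oriented_hypermap_perm_in_arcs[OF M])
      also have "\<dots> = edge_cycle \<alpha> (\<gamma> (act g \<beta>))"
        using \<alpha> \<beta> \<beta>D g by (simp add: edge_cycle_label stable act_eperm)
      also have "\<gamma> (act g \<beta>) = c" using \<beta> \<beta>D g a by (simp add: label_act)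
      finally show ?thesis .
    next
      case False
      then show ?thesis
        using cycle_on_edge_cycle[OF \<alpha>] permutes_not_in[of "edge_cycle \<alpha>" ?y c] img
        by (simp add: map_permutation_def cycle_on_def)
    qed
  qed
qed

text \<open>
  Rotation at a hypervertex preserves the label and rotation at a hyperedge multiplies it on the
  left by an element of the generated subgroup.  Starting from an arc with label \<open>\<one>\<close>, transitivity
  therefore keeps all labels in this subgroup, and every group element is a label.
\<close>
lemma generate_eq_carrier_if_quotients:
  assumes A: "A \<subseteq> carrier G" and \<alpha>\<^sub>0: "\<alpha>\<^sub>0 \<in> arcs M" "\<gamma> \<alpha>\<^sub>0 = \<one>"
    and quot: "\<And>\<alpha>. \<alpha> \<in> arcs M \<Longrightarrow> \<gamma> (eperm M \<alpha>) \<otimes> inv \<gamma> \<alpha> \<in> generate G A"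
  shows "generate G A = carrier G"
proof
  interpret K: subgroup "generate G A" G by (rule G.generate_is_subgroup[OF A])
  show "generate G A \<subseteq> carrier G" by (rule K.subset)
  have labels: "\<gamma> \<beta> \<in> generate G A" if "\<beta> \<in> arcs M" for \<beta>
    using M \<alpha>\<^sub>0(1) that
  proof (rule arcs_induct)
    show "\<gamma> \<alpha>\<^sub>0 \<in> generate G A" using \<alpha>\<^sub>0 by simp
  next
    fix \<alpha> assume "\<alpha> \<in> arcs M" "\<gamma> \<alpha> \<in> generate G A"
    then show "\<gamma> (vperm M \<alpha>) \<in> generate G A" by (simp add: label_vperm)
  next
    fix \<alpha> assume \<alpha>: "\<alpha> \<in> arcs M" and in_gen: "\<gamma> \<alpha> \<in> generate G A"
    have "(\<gamma> (eperm M \<alpha>) \<otimes> inv \<gamma> \<alpha>) \<otimes> \<gamma> \<alpha> \<in> generate G A"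
      using quot[OF \<alpha>] in_gen by (rule K.m_closed)
    then show "\<gamma> (eperm M \<alpha>) \<in> generate G A"
      using \<alpha> by (simp add: G.m_assoc label_closed oriented_hypermap_perm_in_arcs[OF M])
  qed
  show "carrier G \<subseteq> generate G A"
  proof
    fix k assume k: "k \<in> carrier G"
    then have "\<gamma> (act k \<alpha>\<^sub>0) = k" using \<alpha>\<^sub>0 by (simp add: label_act)
    then show "k \<in> generate G A" using labels[of "act k \<alpha>\<^sub>0"] k \<alpha>\<^sub>0 by (simp add: act_closed)
  qed
qed

text \<open>
  The isomorphism sends an arc to its label paired with the label set of its hyperedge.  Every arc
  is a translate of one at the base hypervertex, which puts its image into the form \<open>(k, x k)\<close>
  with \<open>x \<in> C\<close> on which the rotation of hypervertices is defined; for the rotation of hyperedges the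
  arc is instead a translate of one in a chosen representative hyperedge.
\<close>
lemma is_cayley_hypermap_if_simple:
  assumes simple: "simple_underlying M" and fin: "finite (carrier G)"
  shows "is_cayley_hypermap M"
proof -
  let ?D = "arcs M" and ?V = "orbit (vperm M)" and ?E = "orbit (eperm M)"
  note perm = oriented_hypermap_permutation[OF M]
    and sub = oriented_hypermap_orbit_subset[OF M]
    and perm_in = oriented_hypermap_perm_in_arcs[OF M]
  note self = permutation_self_in_orbit[OF perm(1)] permutation_self_in_orbit[OF perm(2)]
  let ?S = edge_labels
  note S_eqD = eperm_orbit_eq_if_edge_labels_eq[OF simple]
  obtain \<alpha>\<^sub>0 where \<alpha>\<^sub>0: "\<alpha>\<^sub>0 \<in> ?D" "\<gamma> \<alpha>\<^sub>0 = \<one>"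
  proof -
    obtain \<alpha> where "\<alpha> \<in> ?D" using M by (auto simp: oriented_hypermap_def)
    then show thesis using that[of "act (inv \<gamma> \<alpha>) \<alpha>"] by (simp add: act_closed label_act label_closed)
  qed
  have V0: "\<alpha> \<in> ?V \<alpha>\<^sub>0 \<longleftrightarrow> \<alpha> \<in> ?D \<and> \<gamma> \<alpha> = \<one>" for \<alpha>
    using \<alpha>\<^sub>0 label_eq_iff[of \<alpha> \<alpha>\<^sub>0] orbit_eq_of_mem[OF perm(1), of \<alpha> \<alpha>\<^sub>0] self(1)[of \<alpha>]
      sub(1)[OF \<alpha>\<^sub>0(1)] by auto
  have translate: "act (inv \<gamma> \<alpha>) \<alpha> \<in> ?V \<alpha>\<^sub>0" if "\<alpha> \<in> ?D" for \<alpha>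
    using that by (simp add: V0 act_closed label_act label_closed)
  define C where "C = ?S ` ?V \<alpha>\<^sub>0"
  have C_one: "x \<subseteq> carrier G \<and> \<one> \<in> x" if "x \<in> C" for x
    using that edge_labels_subset label_in_edge_labels by (force simp: C_def V0)
  have C_translate: "?S \<alpha> #> inv \<gamma> \<alpha> \<in> C" if "\<alpha> \<in> ?D" for \<alpha>
    using translate[OF that] that unfolding C_def
    by (auto simp: label_closed simp flip: edge_labels_act)
  have C_closed: "x #> inv g \<in> C" if x: "x \<in> C" and g: "g \<in> x" for x g
  proof -
    obtain \<alpha> \<beta> where "\<alpha> \<in> ?V \<alpha>\<^sub>0" "x = ?S \<alpha>" "\<beta> \<in> ?E \<alpha>" "g = \<gamma> \<beta>"
      using x g unfolding C_def edge_labels_def by blast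
    then show ?thesis
      using C_translate[of \<beta>] edge_labels_mem[of \<beta> \<alpha>] sub(2)[of \<alpha>] by (auto simp: V0)
  qed
  obtain Y where Y: "Y \<subseteq> C" "non_cayley_equivalent_hyperset G Y" "hyperset_closure G Y = C"
    using G.hyperset_representatives[OF C_one C_closed] by blast
  have inj_S: "inj_on ?S (?V \<alpha>\<^sub>0)"
    by (intro inj_onI arc_eq_if_label_eq S_eqD) (auto simp: V0)
  define \<rho> where "\<rho> = map_permutation (?V \<alpha>\<^sub>0) ?S (perm_restrict (vperm M) (?V \<alpha>\<^sub>0))"
  have \<rho>_cycle: "cycle_on C \<rho>"
    unfolding \<rho>_def C_def
    by (intro cycle_on_map_permutation cycle_on_perm_restrict_orbit perm inj_S)
  have \<rho>: "\<rho> (?S \<alpha>) = ?S (vperm M \<alpha>)" if "\<alpha> \<in> ?V \<alpha>\<^sub>0" for \<alpha>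
    using that inj_S by (simp add: \<rho>_def map_permutation_apply perm_restrict_def)
  \<comment> \<open>An arc at the base hypervertex whose hyperedge has label set \<open>y\<close>.\<close>
  define b where "b = inv_into (?V \<alpha>\<^sub>0) ?S"
  have b: "b y \<in> ?D" "?S (b y) = y" if "y \<in> Y" for y
  proof -
    have "y \<in> ?S ` ?V \<alpha>\<^sub>0" using that Y(1) by (auto simp: C_def)
    then show "b y \<in> ?D" "?S (b y) = y"
      using inv_into_into[of y ?S "?V \<alpha>\<^sub>0"] by (auto simp: b_def f_inv_into_f V0)
  qed
  define \<tau> where "\<tau> y = edge_cycle (b y)" for y
  have ideal: "ideal_cycle G y (\<tau> y)" if "y \<in> Y" for y
    using ideal_edge_cycle[OF simple b(1)[OF that]] b(2)[OF that] by (simp add: \<tau>_def)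
  have gen: "generate G (\<Union>Y) = carrier G"
    using _ \<alpha>\<^sub>0
  proof (rule generate_eq_carrier_if_quotients)
    show sub_gen: "\<Union>Y \<subseteq> carrier G" using Y(1) C_one by blast
    interpret K: subgroup "generate G (\<Union>Y)" G by (rule G.generate_is_subgroup[OF sub_gen])
    have C_gen: "a \<in> generate G (\<Union>Y)" if x: "x \<in> C" and a: "a \<in> x" for x a
    proof -
      obtain y h where y: "y \<in> Y" "h \<in> y" "x = y #> inv h"
        using x unfolding Y(3)[symmetric] hyperset_closure_def by blast
      then obtain c where c: "c \<in> y" "a = c \<otimes> inv h" using a by (auto simp: r_coset_def)
      have "c \<in> generate G (\<Union>Y)" "h \<in> generate G (\<Union>Y)"
        using y c by (blast intro: generate.incl)+
      then show ?thesis using c by simp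
    qed
    fix \<alpha> assume \<alpha>: "\<alpha> \<in> ?D"
    have "\<gamma> (eperm M \<alpha>) \<in> ?S \<alpha>" by (auto simp: edge_labels_def intro: orbit.base)
    then have "\<gamma> (eperm M \<alpha>) \<otimes> inv \<gamma> \<alpha> \<in> ?S \<alpha> #> inv \<gamma> \<alpha>" by (auto simp: r_coset_def)
    then show "\<gamma> (eperm M \<alpha>) \<otimes> inv \<gamma> \<alpha> \<in> generate G (\<Union>Y)"
      using C_gen[OF C_translate[OF \<alpha>]] by blast
  qed
  have data: "cayley_hypermap_data G Y \<rho> \<tau>"
    unfolding cayley_hypermap_data_def
    using fin Y gen \<rho>_cycle ideal by (simp add: G.is_group)
  define \<psi> where "\<psi> \<alpha> = (\<gamma> \<alpha>, ?S \<alpha>)" for \<alpha>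
  have \<psi>_act: "\<psi> (act k \<alpha>) = (k, ?S \<alpha> #> k)" if "\<alpha> \<in> ?V \<alpha>\<^sub>0" "k \<in> carrier G" for k \<alpha>
    using that by (simp add: \<psi>_def V0 label_act edge_labels_act)
  have from_V0: "\<exists>\<beta>\<in>?V \<alpha>\<^sub>0. \<alpha> = act (\<gamma> \<alpha>) \<beta>" if "\<alpha> \<in> ?D" for \<alpha>
    using translate[OF that] that by (auto simp: act_inv label_closed intro!: bexI)
  have arcs: "arcs (CM G Y \<rho> \<tau>) = CM_arcs G Y" by (simp add: CM_def)
  have "hypermap_iso M (CM G Y \<rho> \<tau>) \<psi>"
    unfolding hypermap_iso_def bij_betw_def
  proof (intro conjI ballI)
    show "inj_on \<psi> ?D" by (intro inj_onI arc_eq_if_label_eq S_eqD) (auto simp: \<psi>_def)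
    show \<psi>_image: "\<psi> ` ?D = arcs (CM G Y \<rho> \<tau>)"
    proof (intro equalityI subsetI)
      fix z assume "z \<in> \<psi> ` ?D"
      then obtain \<alpha> \<beta> where "\<alpha> \<in> ?D" "\<beta> \<in> ?V \<alpha>\<^sub>0" "\<alpha> = act (\<gamma> \<alpha>) \<beta>" "z = \<psi> \<alpha>" using from_V0 by blast
      then have "z = (\<gamma> \<alpha>, ?S \<beta> #> \<gamma> \<alpha>)" "\<gamma> \<alpha> \<in> carrier G" "?S \<beta> \<in> C"
        using \<psi>_act[of \<beta> "\<gamma> \<alpha>"] by (auto simp: label_closed C_def)
      then show "z \<in> arcs (CM G Y \<rho> \<tau>)" unfolding arcs CM_arcs_def Y(3) by blast
    next
      fix z assume "z \<in> arcs (CM G Y \<rho> \<tau>)"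
      then obtain k \<beta> where *: "k \<in> carrier G" "\<beta> \<in> ?V \<alpha>\<^sub>0" "z = (k, ?S \<beta> #> k)"
        unfolding arcs CM_arcs_def Y(3) C_def by blast
      then have "z = \<psi> (act k \<beta>)" "act k \<beta> \<in> ?D" by (auto simp: \<psi>_act act_closed V0)
      then show "z \<in> \<psi> ` ?D" by blast
    qed
    fix \<alpha> assume \<alpha>: "\<alpha> \<in> ?D"
    show "\<psi> (vperm M \<alpha>) = vperm (CM G Y \<rho> \<tau>) (\<psi> \<alpha>)"
    proof -
      obtain \<beta> where \<beta>: "\<beta> \<in> ?V \<alpha>\<^sub>0" "\<alpha> = act (\<gamma> \<alpha>) \<beta>" using from_V0[OF \<alpha>] by blast
      define k where "k = \<gamma> \<alpha>"
      have k: "k \<in> carrier G" "\<alpha> = act k \<beta>" using \<alpha> \<beta> by (simp_all add: k_def label_closed)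
      have "vperm M \<alpha> = act k (vperm M \<beta>)" using \<beta> k by (simp add: V0 act_vperm)
      then have "\<psi> (vperm M \<alpha>) = (k, ?S (vperm M \<beta>) #> k)"
        using k \<beta> orbit.step[OF \<beta>(1)] by (simp add: \<psi>_act)
      also have "\<dots> = vperm (CM G Y \<rho> \<tau>) (k, ?S \<beta> #> k)"
        using \<beta> k by (simp add: CM_vperm[OF data] \<rho> Y(3) C_def)
      finally show ?thesis using \<beta> k by (simp add: \<psi>_act)
    qed
    show "\<psi> (eperm M \<alpha>) = eperm (CM G Y \<rho> \<tau>) (\<psi> \<alpha>)"
    proof -
      have "\<psi> \<alpha> \<in> CM_arcs G Y" using \<alpha> \<psi>_image arcs by blast
      then obtain y a h where *: "y \<in> Y" "a \<in> y" "h \<in> carrier G" "\<psi> \<alpha> = (a \<otimes> h, y #> h)"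
        unfolding CM_arcs_altdef[OF data] by blast
      note b_y = b[OF *(1)]
      \<comment> \<open>Both hyperedges have label set \<open>y h\<close>, so \<open>\<alpha>\<close> is the translate by \<open>h\<close> of an arc of the
        hyperedge from which \<open>\<tau> y\<close> was read off.\<close>
      have "?E (act h (b y)) = ?E \<alpha>"
        using * b_y \<alpha> by (intro S_eqD) (simp_all add: act_closed edge_labels_act \<psi>_def)
      then have "\<alpha> \<in> act h ` ?E (b y)" using self(2)[of \<alpha>] * b_y by (simp add: eperm_orbit_act)
      then obtain \<beta> where \<beta>: "\<beta> \<in> ?E (b y)" "\<alpha> = act h \<beta>" by blast
      have \<beta>D: "\<beta> \<in> ?D" using \<beta> sub(2)[OF b_y(1)] by blast
      have "\<gamma> \<beta> \<otimes> h = a \<otimes> h" using * \<beta> \<beta>D by (simp add: \<psi>_def label_act)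
      moreover have "a \<in> carrier G" using * Y(1) C_one by blast
      ultimately have a: "a = \<gamma> \<beta>" using * \<beta>D by (simp add: label_closed)
      have "?S (eperm M \<alpha>) = ?S \<alpha>" by (intro edge_labels_mem orbit.base)
      then have "\<psi> (eperm M \<alpha>) = (\<tau> y a \<otimes> h, y #> h)"
        using * a \<beta> \<beta>D by (simp add: \<psi>_def \<tau>_def edge_cycle_label b_y label_act perm_in flip: act_eperm)
      also have "\<dots> = eperm (CM G Y \<rho> \<tau>) (\<psi> \<alpha>)"
        using * by (simp add: CM_eperm[OF data])
      finally show ?thesis .
    qed
  qed
  with data show ?thesis by (rule is_cayley_hypermapI)
qed

end

end

theorem theorem3p11:
  fixes M :: "'a hypermap"
  assumes "oriented_hypermap M"
    and "simple_underlying M"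
  shows "is_cayley_hypermap M \<longleftrightarrow>
    (\<exists>H. subgroup H (aut_group M) \<and> regular_on_hypervertices M H)"
proof
  assume "is_cayley_hypermap M"
  then obtain G :: "nat monoid" and Y \<rho> \<tau> \<psi>
    where "cayley_hypermap_data G Y \<rho> \<tau>" and iso: "hypermap_iso M (CM G Y \<rho> \<tau>) \<psi>"
    unfolding is_cayley_hypermap_def by blast
  then have "regular_labelling (CM G Y \<rho> \<tau>) G (\<lambda>k (g, e). (g \<otimes>\<^bsub>G\<^esub> k, e #>\<^bsub>G\<^esub> k)) fst"
    by (intro regular_labelling_CM)
  from regular_labelling_transfer[OF assms(1) iso this] assms(1)
  show "\<exists>H. subgroup H (aut_group M) \<and> regular_on_hypervertices M H"
    by (rule regular_labelling.regular_subgroup_exists)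
next
  assume "\<exists>H. subgroup H (aut_group M) \<and> regular_on_hypervertices M H"
  then obtain H where H: "subgroup H (aut_group M)" "regular_on_hypervertices M H" by blast
  then obtain \<gamma> where
      "regular_labelling M ((aut_group M)\<lparr>carrier := H\<rparr>) (\<lambda>\<sigma>. \<sigma>) \<gamma>"
    using regular_labelling_of_regular_subgroup[OF assms(1)] by blast
  moreover have "finite H"
  proof (rule finite_subset)
    show "H \<subseteq> {\<sigma>. \<sigma> permutes arcs M}"
      using subgroup.subset[OF H(1)] by (auto simp: aut_group_def)
    show "finite {\<sigma>. \<sigma> permutes arcs M}"
      using assms(1) by (intro finite_permutations) (simp add: oriented_hypermap_def)
  qed
  ultimately show "is_cayley_hypermap M"
    using assms by (intro regular_labelling.is_cayley_hypermap_if_simple) auto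
qed

end
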